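(* Let $0\le m<\infty$ and let $(M^n,g,v^m\mathrm{dvol})$ be a compact smooth metric measure space. Let $\sigma_{1,2}=\sigma_{1,2}(g,v^m\mathrm{dvol})$ be its weighted Yamabe constant and $\lambda(g,v^m\mathrm{dvol})$ its $m$-energy. Then $$\lambda(g,v^m\mathrm{dvol})=\begin{cases}-\infty&\text{if }\sigma_{1,2}<0,\\0&\text{if }\sigma_{1,2}=0,\\(m+n)\left(\dfrac{\sigma_{1,2}}{n}\right)^{\frac n{m+n}}&\text{if }\sigma_{1,2}>0.\end{cases}$$
   Context: A smooth metric measure space (SMMS) $(M^n,g,v^m\mathrm{dvol})$ is a Riemannian manifold $(M^n,g)$ with a positive function $v\in C^\infty(M)$ and a parameter $m$. Its weighted scalar curvature is $$R_\phi^m[g,v^m\mathrm{dvol}_g]=R-2mv^{-1}\Delta v-m(m-1)v^{-2}|\nabla v|^2 .$$ A positive $u\in C^\infty(M)$ determines the conformally equivalent SMMS with $\hat g=u^{-2}g$, $\hat v=u^{-1}v$, so $\hat v^m\mathrm{dvol}_{\hat g}=u^{-m-n}v^m\mathrm{dvol}_g$. **Weighted Yamabe constant.** $$\sigma_{1,2}(g,v^m\mathrm{dvol})=\inf_{0<u\in C^\infty(M)}\frac{\left(\int_M R_\phi^m[\hat g,\hat v^m\mathrm{dvol}_{\hat g}]\,\hat v^m\mathrm{dvol}_{\hat g}\right)\left(\int_M\hat v^{m-2}\mathrm{dvol}_{\hat g}\right)^{m/n}}{\left(\int_M\hat v^m\mathrm{dvol}_{\hat g}\right)^{(m+n-2)/n}}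 .$$ **$m$-energy.** For a constant $\mu$ the $(m,\mu)$-energy functional is $\mathcal W_\mu^m(g,v^m\mathrm{dvol}_g)=\int_M(R_\phi^m+m\mu v^{-2})v^m\mathrm{dvol}_g$. The $(m,\mu)$-energy is $$\lambda(g,v^m\mathrm{dvol},\mu)=\inf\Big\{\mathcal W_\mu^m(u^{-2}g,u^{-m-n}v^m\mathrm{dvol}_g):0<u\in C^\infty(M),\ \int_Mu^{-m-n}v^m\mathrm{dvol}_g=1\Big\},$$ and the $m$-energy is $\lambda(g,v^m\mathrm{dvol})=\inf_{\tau>0}\lambda(g,(\sqrt\tau\,v)^m\mathrm{dvol}_g,1)$, where the SMMS $(M,g,(\sqrt\tau v)^m\mathrm{dvol}_g)$ has $v$ replaced by $\sqrt\tau\,v$.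
   Formalization: For m=0 and σ_{1,2}<0 the printed value −∞ is false (closed genus-2 surface: λ=σ_{1,2}=−8π), so in that case the statement proved is λ=σ_{1,2}; all other cases are as printed. *)

theory Defs
  imports "HOL-Analysis.Analysis"
begin

section \<open>Smooth functions on open subsets of Euclidean space\<close>

definition partial_deriv :: "'n::finite \<Rightarrow> (real^'n \<Rightarrow> real) \<Rightarrow> real^'n \<Rightarrow> real" where
  "partial_deriv i f x = frechet_derivative f (at x) (axis i 1)"

primrec Ck_on :: "nat \<Rightarrow> (real^'n::finite) set \<Rightarrow> (real^'n \<Rightarrow> real) \<Rightarrow> bool" where
  "Ck_on 0 S f \<longleftrightarrow> continuous_on S f"
| "Ck_on (Suc k) S f \<longleftrightarrow>
     (\<forall>x\<in>S. f differentiable (at x)) \<and> (\<forall>i. Ck_on k S (partial_deriv i f))"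

text \<open>Only used for open sets \<open>S\<close>.\<close>
definition smooth_on :: "(real^'n::finite) set \<Rightarrow> (real^'n \<Rightarrow> real) \<Rightarrow> bool" where
  "smooth_on S f \<longleftrightarrow> (\<forall>k. Ck_on k S f)"


section \<open>Smooth manifolds\<close>

text \<open>
  The manifold is the whole type \<open>'a\<close>. A chart is a pair \<open>(U, \<phi>)\<close>; the values of \<open>\<phi>\<close> outside
  \<open>U\<close> are irrelevant. The dimension is \<open>CARD('n)\<close>, hence at least one. The manifold has no
  boundary, and connectedness is not required.
\<close>
type_synonym ('a, 'n) chart = "'a set \<times> ('a \<Rightarrow> real^'n)"

definition chart_inv :: "('a, 'n::finite) chart \<Rightarrow> real^'n \<Rightarrow> 'a" where
  "chart_inv c = inv_into (fst c) (snd c)"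

definition is_chart :: "('a::t2_space, 'n::finite) chart \<Rightarrow> bool" where
  "is_chart c \<longleftrightarrow> open (fst c) \<and> open (snd c ` fst c) \<and>
     homeomorphism (fst c) (snd c ` fst c) (snd c) (chart_inv c)"

definition transition ::
    "('a, 'n::finite) chart \<Rightarrow> ('a, 'n) chart \<Rightarrow> real^'n \<Rightarrow> real^'n" where
  "transition c d x = snd d (chart_inv c x)"

definition smooth_atlas :: "('a::t2_space, 'n::finite) chart set \<Rightarrow> bool" where
  "smooth_atlas A \<longleftrightarrow>
     (\<forall>c\<in>A. is_chart c) \<and> (\<Union>c\<in>A. fst c) = UNIV \<and>
     (\<forall>c\<in>A. \<forall>d\<in>A. \<forall>i. smooth_on (snd c ` (fst c \<inter> fst d)) (\<lambda>x. transition c d x $ i))"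

definition smooth_fun :: "('a, 'n::finite) chart set \<Rightarrow> ('a \<Rightarrow> real) \<Rightarrow> bool" where
  "smooth_fun A f \<longleftrightarrow> (\<forall>c\<in>A. smooth_on (snd c ` fst c) (\<lambda>x. f (chart_inv c x)))"

definition pos_smooth :: "('a, 'n::finite) chart set \<Rightarrow> ('a \<Rightarrow> real) set" where
  "pos_smooth A = {u. smooth_fun A u \<and> (\<forall>p. 0 < u p)}"


section \<open>Riemannian metrics\<close>

text \<open>
  A metric is given by its components: \<open>g c p $ i $ j\<close> is \<open>g\<^sub>p(\<partial>\<^sub>i, \<partial>\<^sub>j)\<close> for the coordinate
  vector fields of the chart \<open>c\<close>, where \<open>p\<close> lies in the domain of \<open>c\<close>. The last condition
  below is the transformation law of a covariant 2-tensor.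
\<close>
type_synonym ('a, 'n) metric = "('a, 'n) chart \<Rightarrow> 'a \<Rightarrow> real^'n^'n"

definition jacobian ::
    "('a, 'n::finite) chart \<Rightarrow> ('a, 'n) chart \<Rightarrow> 'a \<Rightarrow> real^'n^'n" where
  "jacobian c d p = matrix (frechet_derivative (transition c d) (at (snd c p)))"

definition riemannian_metric ::
    "('a::t2_space, 'n::finite) chart set \<Rightarrow> ('a, 'n) metric \<Rightarrow> bool" where
  "riemannian_metric A g \<longleftrightarrow>
     (\<forall>c\<in>A. \<forall>i j. smooth_on (snd c ` fst c) (\<lambda>x. g c (chart_inv c x) $ i $ j)) \<and>
     (\<forall>c\<in>A. \<forall>p\<in>fst c. transpose (g c p) = g c p \<and> (\<forall>w. w \<noteq> 0 \<longrightarrow> 0 < w \<bullet> (g c p *v w))) \<and>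
     (\<forall>c\<in>A. \<forall>d\<in>A. \<forall>p\<in>fst c \<inter> fst d.
        g c p = transpose (jacobian c d p) ** g d p ** jacobian c d p)"

text \<open>The Riemannian measure: \<open>dvol = sqrt (det g) dx\<close> in every chart.\<close>
definition vol :: "('a::t2_space, 'n::finite) chart set \<Rightarrow> ('a, 'n) metric \<Rightarrow> 'a measure" where
  "vol A g = (THE \<mu>. sets \<mu> = sets borel \<and>
     (\<forall>c\<in>A. \<forall>B\<in>sets borel. B \<subseteq> fst c \<longrightarrow>
        emeasure \<mu> B =
          (\<integral>\<^sup>+x. ennreal (sqrt (det (g c (chart_inv c x)))) * indicator (snd c ` B) x \<partial>lborel)))"


subsection \<open>Coordinate expressions\<close>

text \<open>Here \<open>G\<close> is the matrix of metric components as a function of the coordinates.\<close>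

definition christoffel ::
    "(real^'n::finite \<Rightarrow> real^'n^'n) \<Rightarrow> 'n \<Rightarrow> 'n \<Rightarrow> 'n \<Rightarrow> real^'n \<Rightarrow> real" where
  "christoffel G k i j x = (1/2) * (\<Sum>l\<in>UNIV. matrix_inv (G x) $ k $ l *
     (partial_deriv i (\<lambda>y. G y $ j $ l) x + partial_deriv j (\<lambda>y. G y $ i $ l) x
        - partial_deriv l (\<lambda>y. G y $ i $ j) x))"

text \<open>Sign convention: the Ricci and scalar curvatures of round spheres are positive.\<close>
definition ricci_coord ::
    "(real^'n::finite \<Rightarrow> real^'n^'n) \<Rightarrow> 'n \<Rightarrow> 'n \<Rightarrow> real^'n \<Rightarrow> real" where
  "ricci_coord G i j x =
     (\<Sum>k\<in>UNIV. partial_deriv k (christoffel G k i j) x - partial_deriv j (christoffel G k i k) x)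
     + (\<Sum>k\<in>UNIV. \<Sum>l\<in>UNIV. christoffel G k k l x * christoffel G l i j x
                              - christoffel G k j l x * christoffel G l i k x)"

definition scal_coord :: "(real^'n::finite \<Rightarrow> real^'n^'n) \<Rightarrow> real^'n \<Rightarrow> real" where
  "scal_coord G x = (\<Sum>i\<in>UNIV. \<Sum>j\<in>UNIV. matrix_inv (G x) $ i $ j * ricci_coord G i j x)"

text \<open>The trace of the Hessian (the nonpositive Laplacian).\<close>
definition laplacian_coord ::
    "(real^'n::finite \<Rightarrow> real^'n^'n) \<Rightarrow> (real^'n \<Rightarrow> real) \<Rightarrow> real^'n \<Rightarrow> real" where
  "laplacian_coord G f x = (\<Sum>i\<in>UNIV. \<Sum>j\<in>UNIV. matrix_inv (G x) $ i $ j *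
     (partial_deriv i (partial_deriv j f) x
        - (\<Sum>k\<in>UNIV. christoffel G k i j x * partial_deriv k f x)))"

definition grad_sq_coord ::
    "(real^'n::finite \<Rightarrow> real^'n^'n) \<Rightarrow> (real^'n \<Rightarrow> real) \<Rightarrow> real^'n \<Rightarrow> real" where
  "grad_sq_coord G f x = (\<Sum>i\<in>UNIV. \<Sum>j\<in>UNIV. matrix_inv (G x) $ i $ j *
     (partial_deriv i f x * partial_deriv j f x))"


subsection \<open>Global versions\<close>

text \<open>
  The coordinate expressions above are invariant under change of chart, so each may be evaluated
  at a point in any chart around that point.
\<close>

definition chart_at :: "('a, 'n::finite) chart set \<Rightarrow> 'a \<Rightarrow> ('a, 'n) chart" where
  "chart_at A p = (SOME c. c \<in> A \<and> p \<in> fst c)"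

definition scalar_curvature ::
    "('a, 'n::finite) chart set \<Rightarrow> ('a, 'n) metric \<Rightarrow> 'a \<Rightarrow> real" where
  "scalar_curvature A g p =
     (let c = chart_at A p in scal_coord (\<lambda>x. g c (chart_inv c x)) (snd c p))"

definition laplacian ::
    "('a, 'n::finite) chart set \<Rightarrow> ('a, 'n) metric \<Rightarrow> ('a \<Rightarrow> real) \<Rightarrow> 'a \<Rightarrow> real" where
  "laplacian A g f p =
     (let c = chart_at A p in
        laplacian_coord (\<lambda>x. g c (chart_inv c x)) (\<lambda>x. f (chart_inv c x)) (snd c p))"

definition grad_sq ::
    "('a, 'n::finite) chart set \<Rightarrow> ('a, 'n) metric \<Rightarrow> ('a \<Rightarrow> real) \<Rightarrow> 'a \<Rightarrow> real" where
  "grad_sq A g f p =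
     (let c = chart_at A p in
        grad_sq_coord (\<lambda>x. g c (chart_inv c x)) (\<lambda>x. f (chart_inv c x)) (snd c p))"


section \<open>Smooth metric measure spaces\<close>

text \<open>A smooth metric measure space is represented by \<open>A\<close>, \<open>g\<close>, \<open>v\<close> and the real parameter \<open>m\<close>.\<close>

definition compact_smms ::
    "('a::t2_space, 'n::finite) chart set \<Rightarrow> ('a, 'n) metric \<Rightarrow> ('a \<Rightarrow> real) \<Rightarrow> bool" where
  "compact_smms A g v \<longleftrightarrow>
     compact (UNIV :: 'a set) \<and> smooth_atlas A \<and> riemannian_metric A g \<and> v \<in> pos_smooth A"

definition weighted_scalar ::
    "('a, 'n::finite) chart set \<Rightarrow> ('a, 'n) metric \<Rightarrow> ('a \<Rightarrow> real) \<Rightarrow> real \<Rightarrow> 'a \<Rightarrow> real" where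
  "weighted_scalar A g v m p =
     scalar_curvature A g p - 2 * m * inverse (v p) * laplacian A g v p
       - m * (m - 1) * inverse ((v p)\<^sup>2) * grad_sq A g v p"

definition conf_metric :: "('a \<Rightarrow> real) \<Rightarrow> ('a, 'n::finite) metric \<Rightarrow> ('a, 'n) metric" where
  "conf_metric u g = (\<lambda>c p. inverse ((u p)\<^sup>2) *\<^sub>R g c p)"

definition conf_weight :: "('a \<Rightarrow> real) \<Rightarrow> ('a \<Rightarrow> real) \<Rightarrow> 'a \<Rightarrow> real" where
  "conf_weight u v = (\<lambda>p. inverse (u p) * v p)"

definition yamabe_quotient ::
    "('a::t2_space, 'n::finite) chart set \<Rightarrow> ('a, 'n) metric \<Rightarrow> ('a \<Rightarrow> real) \<Rightarrow> real \<Rightarrow> real" where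
  "yamabe_quotient A g v m =
     (\<integral>p. weighted_scalar A g v m p * v p powr m \<partial>vol A g)
       * (\<integral>p. v p powr (m - 2) \<partial>vol A g) powr (m / real CARD('n))
       / (\<integral>p. v p powr m \<partial>vol A g) powr ((m + real CARD('n) - 2) / real CARD('n))"

definition weighted_yamabe ::
    "('a::t2_space, 'n::finite) chart set \<Rightarrow> ('a, 'n) metric \<Rightarrow> ('a \<Rightarrow> real) \<Rightarrow> real \<Rightarrow> ereal" where
  "weighted_yamabe A g v m =
     (INF u\<in>pos_smooth A. ereal (yamabe_quotient A (conf_metric u g) (conf_weight u v) m))"

definition W_functional ::
    "('a::t2_space, 'n::finite) chart set \<Rightarrow> ('a, 'n) metric \<Rightarrow> ('a \<Rightarrow> real) \<Rightarrow> real \<Rightarrow> real \<Rightarrow> real" where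
  "W_functional A g v m \<mu> =
     (\<integral>p. (weighted_scalar A g v m p + m * \<mu> * inverse ((v p)\<^sup>2)) * v p powr m \<partial>vol A g)"

definition m_mu_energy ::
    "('a::t2_space, 'n::finite) chart set \<Rightarrow> ('a, 'n) metric \<Rightarrow> ('a \<Rightarrow> real) \<Rightarrow> real \<Rightarrow> real \<Rightarrow> ereal" where
  "m_mu_energy A g v m \<mu> =
     (INF u\<in>{u \<in> pos_smooth A. (\<integral>p. u p powr (- m - real CARD('n)) * v p powr m \<partial>vol A g) = 1}.
        ereal (W_functional A (conf_metric u g) (conf_weight u v) m \<mu>))"

definition m_energy ::
    "('a::t2_space, 'n::finite) chart set \<Rightarrow> ('a, 'n) metric \<Rightarrow> ('a \<Rightarrow> real) \<Rightarrow> real \<Rightarrow> ereal" where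
  "m_energy A g v m = (INF \<tau>\<in>{0<..}. m_mu_energy A g (\<lambda>p. sqrt \<tau> * v p) m 1)"

end

theory Submission
  imports Defs
begin

text \<open>
  Write \<open>n\<close> for the dimension and, for a positive smooth \<open>u\<close>, let \<open>S\<close>, \<open>P\<close>, \<open>V\<close> be the integrals of
  the weighted scalar curvature times \<open>v^m\<close>, of \<open>v^(m-2)\<close> and of \<open>v^m\<close> for the space conformally
  changed by \<open>u\<close>. The Yamabe quotient of \<open>u\<close> is \<open>q = S * P^(m/n) / V^((m+n-2)/n)\<close>. Replacing \<open>v\<close> by
  \<open>sqrt \<tau> * v\<close> leaves the weighted scalar curvature unchanged, so the energy of the pair \<open>(u, \<tau>)\<close> is
  \<open>\<tau>^(m/2) * (S + m * P / \<tau>)\<close>, subject to \<open>\<tau>^(m/2) * V = 1\<close>.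

  Multiplying \<open>u\<close> by a constant \<open>c\<close> multiplies \<open>S\<close> and \<open>P\<close> by \<open>c^(2-m-n)\<close> and \<open>V\<close> by \<open>c^(-m-n)\<close>. Hence
  \<open>q\<close> does not change, and if \<open>m > 0\<close> the constraint determines \<open>\<tau>\<close> from \<open>c\<close>. The energies along the
  ray through \<open>u\<close> are the values, for \<open>x = c^2 > 0\<close>, of
  \<open>x * S / V + m * P * V^(2/m-1) * x^(-n/m)\<close>. If \<open>S < 0\<close> this is unbounded below as \<open>x\<close> grows; if
  \<open>S = 0\<close> its infimum is \<open>0\<close>; if \<open>S > 0\<close> the weighted inequality between arithmetic and geometric mean
  gives the minimum \<open>(m+n) * (q/n)^(n/(m+n))\<close>. This is a continuous increasing function of \<open>q\<close>, so the
  infimum over all rays is obtained by inserting the infimum of the Yamabe quotients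
  (\<open>inf_energy_eq_envelope_inf_quotient\<close> and \<open>m_energy_eq_INF_energy\<close>). If \<open>m = 0\<close>, the parameter \<open>\<tau>\<close> has
  no effect, and the constraint \<open>V = 1\<close> only normalises the scale-invariant quotient: the energy is the Yamabe
  constant itself, also when it is negative (\<open>m_energy_eq_yamabe\<close>).

  Two ingredients come from geometry. The first is the behaviour of curvature, Laplacian and gradient under
  constant factors (\<open>weighted_scalar_scaleR\<close>). The second is that the Riemannian measure exists, is unique,
  has finite positive total mass, and acquires the density \<open>u^(-n)\<close> under a conformal change
  (\<open>riemannian_volume_exists\<close>, \<open>vol_eqI\<close>, \<open>vol_conf_metric\<close>, \<open>finite_vol\<close>, \<open>vol_pos\<close>). Existence rests on the
  agreement of the chart expressions on overlaps, that is, on the change of variables formula.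
\<close>

section \<open>Minimising the energy along a scaling ray\<close>

text \<open>
  The minimal energy on a ray on which the Yamabe quotient is \<open>q \<ge> 0\<close>.
\<close>
definition envelope :: "real \<Rightarrow> real \<Rightarrow> real \<Rightarrow> real" where
  "envelope m n q = (m + n) * (q / n) powr (n / (m + n))"

lemma envelope_mono:
  "0 \<le> m \<Longrightarrow> 0 < n \<Longrightarrow> 0 \<le> p \<Longrightarrow> p \<le> q \<Longrightarrow> envelope m n p \<le> envelope m n q"
  unfolding envelope_def by (intro mult_left_mono powr_mono2) (auto simp: divide_right_mono)

lemma envelope_tendsto_right:
  assumes "0 \<le> m" "0 < n" "0 \<le> s"
  shows "(envelope m n \<longlongrightarrow> envelope m n s) (at_right s)"
  unfolding envelope_def
  by (intro tendsto_mult tendsto_const tendsto_powr' tendsto_divide tendsto_ident_at)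
    (use assms in \<open>auto simp: eventually_at_filter\<close>)

lemma weighted_am_gm:
  fixes a b m n :: real
  assumes "0 < a" "0 < b" "0 < m" "0 < n"
  shows "(m + n) * (a powr (n / (m + n)) * b powr (m / (m + n))) \<le> n * a + m * b"
proof -
  have "a powr (n / (m + n)) * b powr (m / (m + n)) \<le> n / (m + n) * a + m / (m + n) * b"
    using assms by (intro Youngs_inequality_0) (auto simp: add_divide_distrib[symmetric])
  then have "(m + n) * (a powr (n / (m + n)) * b powr (m / (m + n)))
     \<le> (m + n) * (n / (m + n) * a + m / (m + n) * b)"
    using assms by (intro mult_left_mono) auto
  also have "\<dots> = n * a + m * b"
    using assms by (subst distrib_left) simp
  finally show ?thesis .
qed

definition yamabe_ratio :: "real \<Rightarrow> real \<Rightarrow> real \<Rightarrow> real \<Rightarrow> real \<Rightarrow> real" where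
  "yamabe_ratio m n S P V = S * P powr (m / n) / V powr ((m + n - 2) / n)"

text \<open>
  The energy \<open>x * S / V + m * P * V^(2/m-1) * x^(-n/m)\<close> at the parameter \<open>x\<close> of a ray. The factor \<open>n\<close> is
  cancelled inside the first summand, so that the weights \<open>n\<close> and \<open>m\<close> of the inequality of means are visible.
\<close>
definition rescaled_energy :: "real \<Rightarrow> real \<Rightarrow> real \<Rightarrow> real \<Rightarrow> real \<Rightarrow> real \<Rightarrow> real" where
  "rescaled_energy m n S P V x = n * (x * S / (n * V)) + m * (P * V powr (2 / m - 1) * x powr (- n / m))"

text \<open>
  The exponents are such that \<open>x\<close> cancels in the weighted geometric mean of the two summands, and the
  remaining powers of \<open>S\<close>, \<open>P\<close>, \<open>V\<close> combine to the scale-invariant quotient. Taking logarithms turns this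
  into a linear identity.
\<close>
lemma geometric_mean_eq_envelope:
  assumes "0 < m" "0 < n" "0 < S" "0 < P" "0 < V" "0 < x"
  shows "(m + n) * ((x * S / (n * V)) powr (n / (m + n))
           * (P * V powr (2 / m - 1) * x powr (- n / m)) powr (m / (m + n)))
     = envelope m n (yamabe_ratio m n S P V)" (is "_ * (?a powr _ * ?b powr _) = _")
proof -
  let ?q = "yamabe_ratio m n S P V / n"
  have pos: "0 < ?a" "0 < ?b" "0 < ?q" using assms by (auto simp: yamabe_ratio_def)
  have la: "ln ?a = ln x + ln S - ln n - ln V"
    using assms by (simp add: ln_mult ln_div)
  have lb: "ln ?b = ln P + (2 / m - 1) * ln V + (- n / m) * ln x"
    using assms by (simp add: ln_mult ln_div ln_powr)
  have lq: "ln ?q = ln S + (m / n) * ln P - (m + n - 2) / n * ln V - ln n"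
    using assms by (simp add: yamabe_ratio_def ln_mult ln_div ln_powr)
  have "n * ln ?a + m * ln ?b = n * ln ?q"
    unfolding la lb lq using assms by (simp add: field_simps)
  then have "n / (m + n) * ln ?a + m / (m + n) * ln ?b = n / (m + n) * ln ?q"
    by (simp add: add_divide_distrib[symmetric])
  moreover have pw: "c powr e = exp (e * ln c)" if "0 < c" for c e :: real
    using that by (simp add: powr_def)
  ultimately show ?thesis
    unfolding envelope_def pw[OF pos(1)] pw[OF pos(2)] pw[OF pos(3)] exp_add[symmetric] by simp
qed

lemma energy_ge_envelope:
  assumes "0 < m" "0 < n" "0 < S" "0 < P" "0 < V" "0 < x"
  shows "envelope m n (yamabe_ratio m n S P V) \<le> rescaled_energy m n S P V x"
  unfolding geometric_mean_eq_envelope[OF assms, symmetric] rescaled_energy_def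
  using assms by (intro weighted_am_gm) auto

text \<open>
  Equality in the inequality of means holds where the two summands without their weights coincide, which
  is a power equation for \<open>x\<close>.
\<close>
lemma energy_attains_envelope:
  assumes "0 < m" "0 < n" "0 < S" "0 < P" "0 < V"
  shows "\<exists>x>0. rescaled_energy m n S P V x = envelope m n (yamabe_ratio m n S P V)"
proof -
  \<comment> \<open>With this K, the equation between the summands reads x powr ((m + n) / m) = K.\<close>
  define K where "K = n * V * (P * V powr (2 / m - 1)) / S"
  define x where "x = K powr (m / (m + n))"
  have K: "0 < K" using assms by (simp add: K_def)
  then have x: "0 < x" by (simp add: x_def)
  let ?a = "x * S / (n * V)" and ?b = "P * V powr (2 / m - 1) * x powr (- n / m)"
  have "x * x powr (n / m) = x powr (1 + n / m)" using x by (simp add: powr_add)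
  also have "1 + n / m = (m + n) / m" using assms by (simp add: field_simps)
  also have "x powr ((m + n) / m) = K" using K assms by (simp add: x_def powr_powr)
  finally have "x = K * x powr (- n / m)"
    using x by (simp add: powr_minus field_simps)
  then have "?a = K * x powr (- n / m) * S / (n * V)" by simp
  also have "\<dots> = ?b" using assms by (simp add: K_def)
  finally have eq: "?a = ?b" .
  have "rescaled_energy m n S P V x = (m + n) * ?a"
    unfolding rescaled_energy_def eq[symmetric] by (subst distrib_right) (rule add.commute)
  also have "?a = ?a powr (n / (m + n)) * ?b powr (m / (m + n))"
    unfolding eq[symmetric] using assms x
    by (simp add: powr_add[symmetric] add_divide_distrib[symmetric] add.commute)
  also have "(m + n) * \<dots> = envelope m n (yamabe_ratio m n S P V)"
    by (rule geometric_mean_eq_envelope[OF assms x])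
  finally show ?thesis using x by blast
qed

lemma energy_arbitrarily_small:
  assumes "0 < m" "0 < n" "0 < V" "0 < e"
  shows "\<exists>x>0. rescaled_energy m n 0 P V x < e"
proof -
  have "((\<lambda>x. m * (P * V powr (2 / m - 1) * x powr (- (n / m)))) \<longlongrightarrow> m * (P * V powr (2 / m - 1) * 0)) at_top"
    using assms by (intro tendsto_mult tendsto_const tendsto_neg_powr filterlim_ident) auto
  then have "\<forall>\<^sub>F x in at_top. m * (P * V powr (2 / m - 1) * x powr (- (n / m))) < e"
    using assms by (intro order_tendstoD) auto
  then have "\<forall>\<^sub>F x in at_top. 0 < x \<and> m * (P * V powr (2 / m - 1) * x powr (- (n / m))) < e"
    using eventually_gt_at_top[of "0::real"] by eventually_elim auto
  then show ?thesis
    unfolding rescaled_energy_def using eventually_happens'[OF trivial_limit_at_top_linorder] by fastforce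
qed

lemma energy_unbounded_below:
  assumes "0 < m" "0 < n" "S < 0" "0 \<le> P" "0 < V"
  shows "\<exists>x>0. rescaled_energy m n S P V x < B"
proof -
  define C where "C = m * (P * V powr (2 / m - 1))"
  define x where "x = max 1 ((C - B + 1) * V / - S)"
  have x: "1 \<le> x" "(C - B + 1) * V / - S \<le> x" by (auto simp: x_def)
  have "(C - B + 1) * V \<le> x * - S" using x(2) assms(3) by (subst (asm) pos_divide_le_eq) auto
  then have "C - B + 1 \<le> x * - S / V" using assms(5) by (subst pos_le_divide_eq)
  then have 1: "x * S / V \<le> B - C - 1" by simp
  have "x powr (- n / m) \<le> x powr 0" using x(1) assms by (intro powr_mono) auto
  then have "C * x powr (- n / m) \<le> C * 1"
    using assms x(1) by (intro mult_left_mono) (auto simp: C_def)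
  then have "x * S / V + C * x powr (- n / m) < B" using 1 by simp
  moreover have "rescaled_energy m n S P V x = x * S / V + C * x powr (- n / m)"
    using assms by (simp add: rescaled_energy_def C_def)
  ultimately show ?thesis using x(1) by (intro exI[of _ x]) simp
qed

text \<open>
  The infimum over all rays and all parameters. The coefficient \<open>P'\<close> of the decreasing summand may
  differ from the \<open>P\<close> of the quotient on rays with \<open>S = 0\<close>: there the infimum is \<open>0\<close> for every \<open>P' \<ge> 0\<close>,
  and the quotient vanishes for every \<open>P\<close>.
\<close>
proposition inf_energy_eq_envelope_inf_quotient:
  fixes S P P' V :: "'i \<Rightarrow> real" and m n :: real
  assumes m: "0 < m" and n: "0 < n" and ne: "X \<noteq> {}"
    and P: "\<And>u. u \<in> X \<Longrightarrow> 0 < P u" and V: "\<And>u. u \<in> X \<Longrightarrow> 0 < V u"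
    and P': "\<And>u. u \<in> X \<Longrightarrow> 0 \<le> P' u" "\<And>u. u \<in> X \<Longrightarrow> S u \<noteq> 0 \<Longrightarrow> P' u = P u"
    and s: "\<sigma> = (INF u\<in>X. ereal (yamabe_ratio m n (S u) (P u) (V u)))"
  shows "(INF (u, x)\<in>X \<times> {0<..}. ereal (rescaled_energy m n (S u) (P' u) (V u) x)) =
    (if \<sigma> < 0 then - \<infinity> else if \<sigma> = 0 then 0 else ereal (envelope m n (real_of_ereal \<sigma>)))"
    (is "?L = _")
proof -
  let ?Q = "\<lambda>u. yamabe_ratio m n (S u) (P u) (V u)"
  have sgn: "?Q u < 0 \<longleftrightarrow> S u < 0" "?Q u = 0 \<longleftrightarrow> S u = 0" if "u \<in> X" for u
    using P[OF that] V[OF that] by (auto simp: yamabe_ratio_def divide_less_0_iff mult_less_0_iff)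
  have up: "?L \<le> ereal (rescaled_energy m n (S u) (P' u) (V u) x)" if "u \<in> X" "0 < x" for u x
    using that by (intro INF_lower2[of "(u, x)"]) auto
  show ?thesis
  proof (cases "\<sigma> < 0")
    case True
    then obtain u where u: "u \<in> X" "?Q u < 0"
      unfolding s INF_less_iff by auto
    have "?L \<le> ereal B" for B
    proof -
      obtain x where "x > 0" "rescaled_energy m n (S u) (P' u) (V u) x < B"
        using energy_unbounded_below[OF m n _ P'(1)[OF u(1)] V[OF u(1)]] sgn u by blast
      then show ?thesis using up[OF u(1), of x] by (meson ereal_less_eq(3) less_imp_le order_trans)
    qed
    then have "?L = - \<infinity>" by (rule ereal_bot)
    then show ?thesis using True by simp
  next
    case False
    have Q0: "0 \<le> ?Q u" if "u \<in> X" for u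
      using INF_lower[OF that, of "\<lambda>u. ereal (?Q u)"] False unfolding s[symmetric]
      by (metis ereal_less_eq(5) linorder_not_le order_trans)
    obtain u0 where "u0 \<in> X" using ne by blast
    then have "\<sigma> \<le> ereal (?Q u0)" unfolding s by (rule INF_lower)
    then have "\<sigma> \<noteq> \<infinity>" by auto
    then obtain q where q: "\<sigma> = ereal q" "0 \<le> q"
      using False by (cases \<sigma>) auto
    have qQ: "q \<le> ?Q u" if "u \<in> X" for u
      using INF_lower[OF that, of "\<lambda>u. ereal (?Q u)"] unfolding s[symmetric] q by simp
    have low: "envelope m n (?Q u) \<le> rescaled_energy m n (S u) (P' u) (V u) x" if u: "u \<in> X" "0 < x" for u x
    proof (cases "S u = 0")
      case True
      then have "?Q u = 0" using sgn u by blast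
      then show ?thesis using True P'(1)[OF u(1)] m u by (simp add: envelope_def rescaled_energy_def)
    next
      case False
      then have "0 < S u" "P' u = P u" using sgn[OF u(1)] Q0[OF u(1)] P'(2)[OF u(1)] by linarith+
      then show ?thesis using energy_ge_envelope[OF m n _ P[OF u(1)] V[OF u(1)] u(2)] by simp
    qed
    have att: "?L \<le> ereal (envelope m n (?Q u))" if u: "u \<in> X" for u
    proof (cases "S u = 0")
      case True
      then have "?Q u = 0" using sgn u by blast
      moreover have "?L \<le> 0"
      proof (rule ereal_le_epsilon2)
        fix e :: real assume "0 < e"
        then obtain x where "x > 0" "rescaled_energy m n 0 (P' u) (V u) x < e"
          using energy_arbitrarily_small[OF m n V[OF u]] by blast
        then show "?L \<le> 0 + ereal e"
          using up[OF u, of x] True by (simp add: order_trans[OF _ less_imp_le])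
      qed
      ultimately show ?thesis by (simp add: envelope_def flip: zero_ereal_def)
    next
      case False
      then have "0 < S u" "P' u = P u" using sgn[OF u] Q0[OF u] P'(2)[OF u] by linarith+
      then show ?thesis using energy_attains_envelope[OF m n _ P[OF u] V[OF u]] up[OF u] by metis
    qed
    have "?L = ereal (envelope m n q)"
    proof (rule antisym)
      show "ereal (envelope m n q) \<le> ?L"
      proof (rule INF_greatest, clarify)
        fix u x assume "u \<in> X" "(0::real) < x"
        then show "ereal (envelope m n q) \<le> ereal (rescaled_energy m n (S u) (P' u) (V u) x)"
          using low[of u x] envelope_mono[of m n q "?Q u"] qQ[of u] q(2) m n by simp
      qed
      \<comment> \<open>The infimum q need not be attained, so the upper bound is a limit from the right.\<close>
      have "?L \<le> ereal (envelope m n r)" if "q < r" for r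
      proof -
        have "\<sigma> < ereal r" using that q by simp
        then obtain u where u: "u \<in> X" "?Q u < r" unfolding s INF_less_iff by auto
        then have "envelope m n (?Q u) \<le> envelope m n r"
          using Q0[OF u(1)] m n by (intro envelope_mono) auto
        then show ?thesis using att[OF u(1)] by (meson ereal_less_eq(3) order_trans)
      qed
      then have "\<forall>\<^sub>F r in at_right q. ?L \<le> ereal (envelope m n r)"
        by (auto simp: eventually_at_filter)
      moreover have "((\<lambda>r. ereal (envelope m n r)) \<longlongrightarrow> ereal (envelope m n q)) (at_right q)"
        using envelope_tendsto_right[of m n q] m n q by (intro tendsto_intros) auto
      ultimately show "?L \<le> ereal (envelope m n q)"
        by (intro tendsto_lowerbound) auto
    qed
    then show ?thesis using False q by (auto simp: envelope_def)
  qed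
qed

section \<open>Curvature under constant factors\<close>

text \<open>
  Partial derivatives only depend on the germ of the function. The coordinate expressions are controlled on the
  image of the chart only, so every identity between functions below is used through its germ.
\<close>
lemma partial_deriv_cong_open:
  assumes "open S" "x \<in> S" "\<And>y. y \<in> S \<Longrightarrow> f y = h y"
  shows "partial_deriv i f x = partial_deriv i h x"
proof -
  have "(f has_derivative D) (at x) \<longleftrightarrow> (h has_derivative D) (at x)" for D
    using has_derivative_transform_within_open[OF _ assms(1,2), of f D UNIV h]
      has_derivative_transform_within_open[OF _ assms(1,2), of h D UNIV f] assms(3) by auto
  then show ?thesis
    by (simp add: partial_deriv_def frechet_derivative_def)
qed

lemma differentiable_cong_open:
  assumes "open S" "x \<in> S" "\<And>y. y \<in> S \<Longrightarrow> f y = h y" "h differentiable (at x)"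
  shows "f differentiable (at x)"
  using assms has_derivative_transform_within_open[OF _ assms(1,2), of h _ UNIV f]
  unfolding differentiable_def by auto

lemma partial_deriv_eqI:
  "(f has_derivative D) (at x) \<Longrightarrow> partial_deriv i f x = D (axis i 1)"
  by (simp add: partial_deriv_def frechet_derivative_at[symmetric])

lemma partial_deriv_cmult:
  assumes "f differentiable (at x)"
  shows "partial_deriv i (\<lambda>y. c * f y) x = c * partial_deriv i f x"
proof -
  obtain D where D: "(f has_derivative D) (at x)"
    using assms by (auto simp: differentiable_def)
  show ?thesis
    using partial_deriv_eqI[OF D] partial_deriv_eqI[OF has_derivative_mult_right[OF D]] by simp
qed

lemma partial_deriv_const: "partial_deriv i (\<lambda>y. c) = (\<lambda>x. 0)"
  by (rule ext) (simp add: partial_deriv_eqI[OF has_derivative_const])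

text \<open>
  Needed because a derivative formula holds on \<open>S\<close> only, whereas the next derivative is taken of the
  function \<open>partial_deriv i f\<close>, which is defined everywhere.
\<close>
lemma Ck_on_cong_open:
  assumes "open S" "\<And>y. y \<in> S \<Longrightarrow> f y = h y" "Ck_on k S f"
  shows "Ck_on k S h"
  using assms(2,3)
proof (induction k arbitrary: f h)
  case 0
  then show ?case by (simp cong: continuous_on_cong)
next
  case (Suc k)
  have eq: "h y = f y" if "y \<in> S" for y using Suc.prems(1) that by simp
  have "Ck_on k S (partial_deriv i h)" for i
  proof (rule Suc.IH)
    show "partial_deriv i f y = partial_deriv i h y" if "y \<in> S" for y
      by (rule partial_deriv_cong_open[OF assms(1) that Suc.prems(1)])
    show "Ck_on k S (partial_deriv i f)" using Suc.prems(2) by simp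
  qed
  moreover have "h differentiable (at x)" if "x \<in> S" for x
    by (rule differentiable_cong_open[OF assms(1) that eq]) (use Suc.prems(2) that in simp_all)
  ultimately show ?case by simp
qed

lemma Ck_on_cmult:
  assumes "open S" "Ck_on k S f"
  shows "Ck_on k S (\<lambda>x. c * f x)"
  using assms(2)
proof (induction k arbitrary: f)
  case 0
  then show ?case by (simp add: continuous_on_mult_left)
next
  case (Suc k)
  have "Ck_on k S (partial_deriv i (\<lambda>x. c * f x))" for i
  proof (rule Ck_on_cong_open[OF assms(1)])
    show "Ck_on k S (\<lambda>x. c * partial_deriv i f x)" by (rule Suc.IH) (use Suc.prems in simp)
    show "c * partial_deriv i f y = partial_deriv i (\<lambda>x. c * f x) y" if "y \<in> S" for y
      using Suc.prems that by (simp add: partial_deriv_cmult)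
  qed
  then show ?case using Suc.prems by auto
qed

lemma Ck_on_const: "Ck_on k S (\<lambda>x. c)"
  by (induction k arbitrary: c) (auto simp: partial_deriv_const)

lemma smooth_on_differentiable:
  assumes "smooth_on S f" "x \<in> S"
  shows "f differentiable (at x)"
proof -
  have "Ck_on (Suc 0) S f" using assms(1) unfolding smooth_on_def by blast
  then show ?thesis using assms(2) by simp
qed

lemma smooth_on_partial_deriv_differentiable:
  assumes "smooth_on S f" "x \<in> S"
  shows "partial_deriv i f differentiable (at x)"
proof -
  have "Ck_on (Suc (Suc 0)) S f" using assms(1) unfolding smooth_on_def by blast
  then show ?thesis using assms(2) by simp
qed

lemma smooth_on_continuous:
  assumes "smooth_on S f"
  shows "continuous_on S f"
proof -
  have "Ck_on 0 S f" using assms(1) unfolding smooth_on_def by blast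
  then show ?thesis by simp
qed

lemma partial_deriv_quotient:
  assumes "a differentiable (at x)" "b differentiable (at x)" "a x \<noteq> 0"
  shows "partial_deriv i (\<lambda>y. inverse (a y) * b y) x
    = inverse (a x) * partial_deriv i b x - inverse (a x) * partial_deriv i a x * inverse (a x) * b x"
proof -
  obtain D E where D: "(a has_derivative D) (at x)" and E: "(b has_derivative E) (at x)"
    using assms by (auto simp: differentiable_def)
  have "((\<lambda>y. inverse (a y) * b y) has_derivative
      (\<lambda>h. inverse (a x) * E h + - (inverse (a x) * D h * inverse (a x)) * b x)) (at x)"
    by (rule has_derivative_mult[OF Deriv.has_derivative_inverse[OF assms(3) D] E])
  from partial_deriv_eqI[OF this, of i] show ?thesis
    by (simp add: partial_deriv_eqI[OF D] partial_deriv_eqI[OF E])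
qed

text \<open>
  The order of differentiability that the Laplacian of the weight \<open>v / u\<close> requires.
\<close>
lemma quotient_twice_differentiable:
  assumes S: "open S" and a: "smooth_on S a" and b: "smooth_on S b" 
    and nz: "\<And>y. y \<in> S \<Longrightarrow> a y \<noteq> 0" and x: "x \<in> S"
  shows "(\<lambda>y. inverse (a y) * b y) differentiable (at x)"
    and "partial_deriv i (\<lambda>y. inverse (a y) * b y) differentiable (at x)"
proof -
  note d = smooth_on_differentiable[OF a] smooth_on_differentiable[OF b]
    smooth_on_partial_deriv_differentiable[OF a] smooth_on_partial_deriv_differentiable[OF b]
  show "(\<lambda>y. inverse (a y) * b y) differentiable (at x)"
    using d x nz by (intro differentiable_mult differentiable_inverse) auto
  show "partial_deriv i (\<lambda>y. inverse (a y) * b y) differentiable (at x)"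
  proof (rule differentiable_cong_open[OF S x])
    show "partial_deriv i (\<lambda>y. inverse (a y) * b y) y
      = inverse (a y) * partial_deriv i b y - inverse (a y) * partial_deriv i a y * inverse (a y) * b y"
      if "y \<in> S" for y using that d nz by (intro partial_deriv_quotient) auto
    show "(\<lambda>y. inverse (a y) * partial_deriv i b y
       - inverse (a y) * partial_deriv i a y * inverse (a y) * b y) differentiable (at x)"
      using d x nz by (intro differentiable_mult differentiable_inverse differentiable_diff) auto
  qed
qed

lemma matrix_inv_unique:
  fixes M :: "real^'n::finite^'n"
  assumes "M ** N = mat 1" "N ** M = mat 1"
  shows "matrix_inv M = N"
proof -
  have "M ** matrix_inv M = mat 1 \<and> matrix_inv M ** M = mat 1"
    unfolding matrix_inv_def by (rule someI) (use assms in auto)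
  then have "matrix_inv M = matrix_inv M ** (M ** N)" using assms by simp
  also have "\<dots> = N" using \<open>_ \<and> _\<close> by (simp add: matrix_mul_assoc)
  finally show ?thesis .
qed

lemma matrix_inv_scaleR:
  fixes M :: "real^'n::finite^'n"
  assumes "invertible M" "k \<noteq> 0"
  shows "matrix_inv (k *\<^sub>R M) = inverse k *\<^sub>R matrix_inv M"
proof -
  obtain N where N: "M ** N = mat 1" "N ** M = mat 1"
    using assms(1) unfolding invertible_def by auto
  have *: "(a *\<^sub>R B) ** (b *\<^sub>R C) = (a * b) *\<^sub>R (B ** C)" for a b and B C :: "real^'n^'n"
    by (simp add: matrix_matrix_mult_def vec_eq_iff sum_distrib_left mult_ac)
  have "matrix_inv (k *\<^sub>R M) = inverse k *\<^sub>R N"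
    using N assms(2) by (intro matrix_inv_unique) (simp_all add: *)
  then show ?thesis using matrix_inv_unique[OF N] by simp
qed

text \<open>
  The factor \<open>k\<close> of the first derivatives of the metric cancels against the factor \<open>1 / k\<close> of its inverse.
  Consequently the Ricci tensor is unchanged as well, and every trace with the inverse metric is divided
  by \<open>k\<close>.
\<close>
lemma christoffel_scaleR:
  assumes "open S" "x \<in> S" "k \<noteq> 0" "\<And>y. y \<in> S \<Longrightarrow> H y = k *\<^sub>R G y"
    "\<And>i j. (\<lambda>y. G y $ i $ j) differentiable (at x)" "invertible (G x)"
  shows "christoffel H a i j x = christoffel G a i j x"
proof -
  have pd: "partial_deriv i (\<lambda>y. H y $ j $ l) x = k * partial_deriv i (\<lambda>y. G y $ j $ l) x" for i j l
    using partial_deriv_cong_open[OF assms(1,2), of "\<lambda>y. H y $ j $ l" "\<lambda>y. k * G y $ j $ l"]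
      partial_deriv_cmult[OF assms(5)] assms(4) by simp
  have H: "H x = k *\<^sub>R G x" using assms by simp
  show ?thesis
    unfolding christoffel_def pd H matrix_inv_scaleR[OF assms(6,3)]
    using assms(3) by (auto intro!: sum.cong simp: field_simps)
qed

lemma ricci_coord_scaleR:
  assumes "open S" "x \<in> S" "k \<noteq> 0" "\<And>y. y \<in> S \<Longrightarrow> H y = k *\<^sub>R G y"
    "\<And>y i j. y \<in> S \<Longrightarrow> (\<lambda>y. G y $ i $ j) differentiable (at y)" "\<And>y. y \<in> S \<Longrightarrow> invertible (G y)"
  shows "ricci_coord H i j x = ricci_coord G i j x"
proof -
  have c: "christoffel H a i j y = christoffel G a i j y" if "y \<in> S" for a i j y
    by (rule christoffel_scaleR[OF assms(1) that assms(3,4)]) (use that assms(5,6) in auto)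
  have "partial_deriv l (christoffel H a i j) x = partial_deriv l (christoffel G a i j) x" for l a i j
    using c by (intro partial_deriv_cong_open[OF assms(1,2)]) auto
  then show ?thesis using c[OF assms(2)] by (simp add: ricci_coord_def)
qed

lemma scal_coord_scaleR:
  assumes "open S" "x \<in> S" "k \<noteq> 0" "\<And>y. y \<in> S \<Longrightarrow> H y = k *\<^sub>R G y"
    "\<And>y i j. y \<in> S \<Longrightarrow> (\<lambda>y. G y $ i $ j) differentiable (at y)" "\<And>y. y \<in> S \<Longrightarrow> invertible (G y)"
  shows "scal_coord H x = inverse k * scal_coord G x"
proof -
  have H: "H x = k *\<^sub>R G x" using assms by simp
  have ric: "ricci_coord H i j x = ricci_coord G i j x" for i j
    by (rule ricci_coord_scaleR[OF assms(1-4)]) (use assms(5,6) in auto)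
  show ?thesis
    unfolding scal_coord_def ric H
      matrix_inv_scaleR[OF assms(6)[OF assms(2)] assms(3)]
    by (simp add: sum_distrib_left mult.assoc)
qed

lemma laplacian_coord_scaleR:
  assumes "open S" "x \<in> S" "k \<noteq> 0" "\<And>y. y \<in> S \<Longrightarrow> H y = k *\<^sub>R G y"
    "\<And>y i j. y \<in> S \<Longrightarrow> (\<lambda>y. G y $ i $ j) differentiable (at y)" "\<And>y. y \<in> S \<Longrightarrow> invertible (G y)"
    "\<And>y. y \<in> S \<Longrightarrow> f differentiable (at y)"
    "\<And>i. partial_deriv i f differentiable (at x)"
  shows "laplacian_coord H (\<lambda>y. s * f y) x = inverse k * s * laplacian_coord G f x"
proof -
  have H: "H x = k *\<^sub>R G x" using assms by simp
  have c: "christoffel H a i j x = christoffel G a i j x" for a i j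
    by (rule christoffel_scaleR[OF assms(1-4)]) (use assms(2,5,6) in auto)
  have d: "partial_deriv i (\<lambda>y. s * f y) x = s * partial_deriv i f x" for i
    using assms(2,7) by (intro partial_deriv_cmult) auto
  have e: "partial_deriv i (partial_deriv j (\<lambda>y. s * f y)) x = s * partial_deriv i (partial_deriv j f) x" for i j
  proof -
    have "partial_deriv i (partial_deriv j (\<lambda>y. s * f y)) x = partial_deriv i (\<lambda>y. s * partial_deriv j f y) x"
      by (rule partial_deriv_cong_open[OF assms(1,2)]) (rule partial_deriv_cmult[OF assms(7)])
    then show ?thesis using partial_deriv_cmult[OF assms(8)] by simp
  qed
  show ?thesis
    unfolding laplacian_coord_def c d e H matrix_inv_scaleR[OF assms(6)[OF assms(2)] assms(3)]
    by (simp add: sum_distrib_left algebra_simps)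
qed

lemma grad_sq_coord_scaleR:
  assumes "k \<noteq> 0" "H x = k *\<^sub>R G x" "invertible (G x)" "f differentiable (at x)"
  shows "grad_sq_coord H (\<lambda>y. s * f y) x = inverse k * s\<^sup>2 * grad_sq_coord G f x"
  unfolding grad_sq_coord_def partial_deriv_cmult[OF assms(4)] assms(2) matrix_inv_scaleR[OF assms(3,1)]
  by (simp add: sum_distrib_left algebra_simps power2_eq_square)

text \<open>
  The terms \<open>\<Delta>v / v\<close> and \<open>\<bar>\<nabla>v\<bar>^2 / v^2\<close> are homogeneous of degree \<open>0\<close> in \<open>v\<close>, hence insensitive to \<open>s\<close>.
  The point \<open>p\<close> is evaluated in the same chart on both sides.
\<close>
lemma weighted_scalar_scaleR:
  assumes "is_chart c" "c = chart_at A p" "p \<in> fst c" "k \<noteq> 0" "s \<noteq> 0"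
    "\<And>x i j. x \<in> snd c ` fst c \<Longrightarrow> (\<lambda>x. G c (chart_inv c x) $ i $ j) differentiable (at x)"
    "\<And>q. q \<in> fst c \<Longrightarrow> invertible (G c q)"
    "\<And>x. x \<in> snd c ` fst c \<Longrightarrow> (\<lambda>x. w (chart_inv c x)) differentiable (at x)"
    "\<And>x i. x \<in> snd c ` fst c \<Longrightarrow> partial_deriv i (\<lambda>x. w (chart_inv c x)) differentiable (at x)"
  shows "weighted_scalar A (\<lambda>d q. k *\<^sub>R G d q) (\<lambda>q. s * w q) m p = inverse k * weighted_scalar A G w m p"
proof -
  let ?S = "snd c ` fst c"
  let ?G = "\<lambda>x. G c (chart_inv c x)"
  have S: "open ?S" and x: "snd c p \<in> ?S" using assms unfolding is_chart_def by auto
  have inv: "invertible (?G y)" if "y \<in> ?S" for y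
    unfolding chart_inv_def by (rule assms(7)[OF inv_into_into[OF that]])
  note a1 = S x assms(4) refl assms(6) inv
  have 1: "scalar_curvature A (\<lambda>d q. k *\<^sub>R G d q) p = inverse k * scalar_curvature A G p"
    unfolding scalar_curvature_def Let_def assms(2)[symmetric] by (rule scal_coord_scaleR[OF a1])
  have 2: "laplacian A (\<lambda>d q. k *\<^sub>R G d q) (\<lambda>q. s * w q) p = inverse k * s * laplacian A G w p"
    unfolding laplacian_def Let_def assms(2)[symmetric]
    by (rule laplacian_coord_scaleR[OF a1]) (use x assms(8,9) in auto)
  have 3: "grad_sq A (\<lambda>d q. k *\<^sub>R G d q) (\<lambda>q. s * w q) p = inverse k * s\<^sup>2 * grad_sq A G w p"
    unfolding grad_sq_def Let_def assms(2)[symmetric]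
    by (rule grad_sq_coord_scaleR) (use assms(4) inv[OF x] assms(8)[OF x] in auto)
  have 4: "inverse (s * w p) * (inverse k * s * L) = inverse k * (inverse (w p) * L)" for L
    using assms(5) by simp
  have 5: "inverse ((s * w p)\<^sup>2) * (inverse k * s\<^sup>2 * L) = inverse k * (inverse ((w p)\<^sup>2) * L)" for L
    using assms(5) by (simp add: power_mult_distrib)
  show ?thesis
    unfolding weighted_scalar_def 1 2 3 mult.assoc[of "2 * m"] mult.assoc[of "m * (m - 1)"] 4 5
    by (simp add: algebra_simps)
qed

section \<open>Change of variables\<close>

text \<open>
  The formula \<open>has_absolute_integral_change_of_variables\<close> concerns vectors over a well-ordered index type. An
  arbitrary finite index type is in bijection with the following well-ordered one, and the formula
  is transported along the renaming of coordinates.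
\<close>
typedef 'n ordered_index = "{..<CARD('n::finite)}"
  by (rule exI[of _ 0]) simp

instantiation ordered_index :: (finite) linorder
begin
definition "a \<le> b \<longleftrightarrow> Rep_ordered_index a \<le> Rep_ordered_index b"
definition "a < b \<longleftrightarrow> Rep_ordered_index a < Rep_ordered_index b"
instance
  by intro_classes (auto simp: less_eq_ordered_index_def less_ordered_index_def Rep_ordered_index_inject)
end

instance ordered_index :: (finite) finite
proof
  show "finite (UNIV :: 'a ordered_index set)"
    unfolding type_definition.univ[OF type_definition_ordered_index] by simp
qed

instance ordered_index :: (finite) wellorder
proof (rule wf_wellorderI)
  show "wf {(x :: 'a ordered_index, y). x < y}"
    by (auto simp: trancl_def tranclp_less intro!: finite_acyclic_wf acyclicI)
qed intro_classes

lemma card_ordered_index: "CARD('n ordered_index) = CARD('n::finite)"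
  using type_definition.card[OF type_definition_ordered_index] by simp

lemma ordered_index_bij: "\<exists>e :: 'n ordered_index \<Rightarrow> 'n::finite. bij e"
  using finite_same_card_bij[of "UNIV :: 'n ordered_index set" "UNIV :: 'n set"] card_ordered_index by auto

lemma det_reindex:
  fixes M :: "real^'n::finite^'n" and e :: "'k::finite \<Rightarrow> 'n"
  assumes e: "bij e"
  shows "det (\<chi> a b. M $ e a $ e b) = det M"
proof -
  let ?e' = "inv e"
  have e': "bij ?e'" using e by (rule bij_imp_bij_inv)
  have ee: "e (?e' x) = x" "?e' (e y) = y" for x y
    using e by (auto simp: bij_is_surj surj_f_inv_f bij_is_inj inv_f_f)
  let ?j = "map_permutation UNIV e" and ?i = "map_permutation UNIV ?e'"
  have j: "?j p (e a) = e (p a)" for p a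
    using e by (intro map_permutation_apply) (auto simp: bij_is_inj)
  show ?thesis
    unfolding det_def
  proof (rule sum.reindex_bij_witness[where i = ?i and j = ?j], goal_cases)
    case (1 p)
    then show ?case using e ee by (intro map_permutation_compose_inv) auto
  next
    case (2 p)
    then show ?case using e by (auto intro: map_permutation_permutes)
  next
    case (3 p)
    then show ?case using e' ee by (intro map_permutation_compose_inv) auto
  next
    case (4 p)
    then show ?case using e' by (auto intro: map_permutation_permutes)
  next
    case (5 p)
    have "sign (?j p) = sign p"
      using 5 e by (intro sign_map_permutation) (auto simp: bij_is_inj)
    moreover have "(\<Prod>i\<in>UNIV. M $ i $ ?j p i) = (\<Prod>a\<in>UNIV. M $ e a $ ?j p (e a))"
      using prod.reindex_bij_betw[OF e, of "\<lambda>i. M $ i $ ?j p i"] by simp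
    ultimately show ?case by (simp add: j)
  qed
qed

lemma prod_Basis_vec:
  fixes x :: "real^'n::finite"
  shows "(\<Prod>b\<in>Basis. x \<bullet> b) = (\<Prod>i\<in>UNIV. x $ i)"
proof -
  have "Basis = range (\<lambda>i::'n. axis i (1::real))" by (auto simp: Basis_vec_def)
  then have "(\<Prod>b\<in>Basis. x \<bullet> b) = (\<Prod>b\<in>range (\<lambda>i::'n. axis i (1::real)). x \<bullet> b)" by (rule arg_cong)
  also have "\<dots> = (\<Prod>i\<in>UNIV. x $ i)"
    by (subst prod.reindex) (auto simp: inj_on_def axis_eq_axis inner_axis)
  finally show ?thesis .
qed

lemma lborel_reindex:
  fixes e :: "'k::finite \<Rightarrow> 'n::finite"
  assumes e: "bij e"
  shows "(lborel :: (real^'n) measure) = distr lborel borel (\<lambda>y::real^'k. \<chi> i. y $ inv e i)"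
proof (rule lborel_eqI)
  let ?L = "\<lambda>y::real^'k. \<chi> i. y $ inv e i"
  have ee: "e (inv e x) = x" "inv e (e y) = y" for x y
    using e by (auto simp: bij_is_surj surj_f_inv_f bij_is_inj inv_f_f)
  fix l u :: "real^'n" assume le: "\<And>b. b \<in> Basis \<Longrightarrow> l \<bullet> b \<le> u \<bullet> b"
  have lu: "l $ i \<le> u $ i" for i using le[of "axis i 1"] by (simp add: inner_axis axis_in_Basis_iff)
  have "continuous_on UNIV ?L" by (intro continuous_intros)
  then have [measurable]: "?L \<in> borel_measurable borel" by (rule borel_measurable_continuous_onI)
  have "emeasure (distr lborel borel ?L) (box l u) = emeasure lborel (?L -` box l u)"
    by (subst emeasure_distr) auto
  also have "?L -` box l u = box (\<chi> a. l $ e a) (\<chi> a. u $ e a)"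
    by (auto simp: mem_box_cart) (metis ee)+
  also have "emeasure lborel \<dots> = (\<Prod>a\<in>UNIV. u $ e a - l $ e a)"
  proof (subst emeasure_lborel_box)
    show "(\<chi> a. l $ e a) \<bullet> b \<le> (\<chi> a. u $ e a) \<bullet> b" if "b \<in> Basis" for b :: "real^'k"
      using that lu by (auto simp: Basis_vec_def inner_axis)
  qed (simp add: prod_Basis_vec)
  also have "(\<Prod>a\<in>UNIV. u $ e a - l $ e a) = (\<Prod>i\<in>UNIV. u $ i - l $ i)"
    using prod.reindex_bij_betw[OF e, of "\<lambda>i. u $ i - l $ i"] by simp
  finally show "emeasure (distr lborel borel ?L) (box l u) = (\<Prod>b\<in>Basis. (u - l) \<bullet> b)"
    by (simp add: prod_Basis_vec)
qed simp

text \<open>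
  For nonnegative functions, a finite value of the integral says the same in the two theories of integration.
\<close>
lemma absolutely_integrable_nonneg_iff_nn_integral:
  fixes f :: "'a::euclidean_space \<Rightarrow> real"
  assumes "\<And>x. x \<in> S \<Longrightarrow> 0 \<le> f x" "(\<lambda>x. indicator S x * f x) \<in> borel_measurable borel" "0 \<le> r"
  shows "f absolutely_integrable_on S \<and> integral S f = r \<longleftrightarrow> (\<integral>\<^sup>+x. ennreal (f x) * indicator S x \<partial>lborel) = ennreal r"
proof
  assume "f absolutely_integrable_on S \<and> integral S f = r"
  then have "(f has_integral r) S"
    using set_lebesgue_integral_eq_integral(1) integrable_integral by blast
  then show "(\<integral>\<^sup>+x. ennreal (f x) * indicator S x \<partial>lborel) = ennreal r"
    using assms(1) by (intro nn_integral_has_integral_lebesgue') auto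
next
  assume *: "(\<integral>\<^sup>+x. ennreal (f x) * indicator S x \<partial>lborel) = ennreal r"
  have "(\<integral>\<^sup>+x. ennreal (f x) * indicator S x \<partial>lborel) = (\<integral>\<^sup>+x. ennreal (indicator S x * f x) \<partial>lborel)"
    by (intro nn_integral_cong) (auto simp: indicator_def)
  then have "((\<lambda>x. indicator S x * f x) has_integral r) UNIV"
    using * assms by (intro nn_integral_has_integral) (auto simp: indicator_def)
  moreover have "(\<lambda>x. indicator S x * f x) = (\<lambda>x. if x \<in> S then f x else 0)"
    by (auto simp: indicator_def)
  ultimately have "(f has_integral r) S" by (simp add: has_integral_restrict_UNIV)
  then show "f absolutely_integrable_on S \<and> integral S f = r"
    using assms(1) by (auto intro!: nonnegative_absolutely_integrable_1 simp: has_integral_iff)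
qed

text \<open>
  Integrability and the value of the integral are transferred in both directions, so the two sides agree
  whenever one of them is finite, and therefore also when one of them is infinite.
\<close>
lemma nn_integral_change_of_variables_wellorder:
  fixes f :: "real^'m::{finite,wellorder} \<Rightarrow> real" and g :: "real^'m::_ \<Rightarrow> real^'m::_"
  assumes S: "S \<in> sets borel"
    and der: "\<And>x. x \<in> S \<Longrightarrow> (g has_derivative g' x) (at x within S)"
    and inj: "inj_on g S" and f: "\<And>y. y \<in> g ` S \<Longrightarrow> 0 \<le> f y"
    and m1: "(\<lambda>y. indicator (g ` S) y * f y) \<in> borel_measurable borel"
    and m2: "(\<lambda>x. indicator S x * (\<bar>det (matrix (g' x))\<bar> * f (g x))) \<in> borel_measurable borel"
  shows "(\<integral>\<^sup>+y. ennreal (f y) * indicator (g ` S) y \<partial>lborel)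
    = (\<integral>\<^sup>+x. ennreal (\<bar>det (matrix (g' x))\<bar> * f (g x)) * indicator S x \<partial>lborel)" (is "?A = ?B")
proof -
  let ?h = "\<lambda>x. \<bar>det (matrix (g' x))\<bar> * f (g x)"
  \<comment> \<open>The formula is stated for vector-valued functions; real functions enter as vectors of length one.\<close>
  have 1: "(\<lambda>x. vec (F x) :: real^1) absolutely_integrable_on T \<and> integral T (\<lambda>x. vec (F x) :: real^1) = vec b \<longleftrightarrow>
      F absolutely_integrable_on T \<and> integral T F = b" for F :: "real^'m::_ \<Rightarrow> real" and T b
  proof -
    have "(\<lambda>x. vec (F x) :: real^1) absolutely_integrable_on T \<longleftrightarrow> F absolutely_integrable_on T"
      by (simp add: absolutely_integrable_on_1_iff)
    moreover have "integral T (\<lambda>x. vec (F x) :: real^1) = vec (integral T F)"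
      by (simp add: integral_on_1_eq)
    moreover have "(vec (integral T F) :: real^1) = vec b \<longleftrightarrow> integral T F = b"
      by (simp add: vec_eq_iff)
    ultimately show ?thesis by simp
  qed
  have sc: "\<bar>det (matrix (g' x))\<bar> *\<^sub>R (vec (f (g x)) :: real^1) = vec (?h x)" for x
    by (simp add: vec_eq_iff)
  have "?B = ennreal b \<longleftrightarrow> ?A = ennreal b" if "0 \<le> b" for b
  proof -
    have "?B = ennreal b \<longleftrightarrow> ?h absolutely_integrable_on S \<and> integral S ?h = b"
      using m2 that f by (intro absolutely_integrable_nonneg_iff_nn_integral[symmetric]) auto
    also have "\<dots> \<longleftrightarrow> f absolutely_integrable_on (g ` S) \<and> integral (g ` S) f = b"
      using has_absolute_integral_change_of_variables[OF _ der inj, of "\<lambda>x. vec (f x) :: real^1" "vec b"] S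
      unfolding sc 1 by (simp add: sets_completionI_sets)
    also have "\<dots> \<longleftrightarrow> ?A = ennreal b"
      using m1 that f by (intro absolutely_integrable_nonneg_iff_nn_integral) auto
    finally show ?thesis .
  qed
  then show ?thesis by (cases ?A; cases ?B) auto
qed

lemma nn_integral_change_of_variables:
  fixes f :: "real^'n::finite \<Rightarrow> real" and g :: "real^'n \<Rightarrow> real^'n"
  assumes S: "S \<in> sets borel"
    and der: "\<And>x. x \<in> S \<Longrightarrow> (g has_derivative g' x) (at x within S)"
    and inj: "inj_on g S" and f: "\<And>y. y \<in> g ` S \<Longrightarrow> 0 \<le> f y"
    and m1: "(\<lambda>y. indicator (g ` S) y * f y) \<in> borel_measurable borel"
    and m2: "(\<lambda>x. indicator S x * (\<bar>det (matrix (g' x))\<bar> * f (g x))) \<in> borel_measurable borel"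
  shows "(\<integral>\<^sup>+y. ennreal (f y) * indicator (g ` S) y \<partial>lborel)
    = (\<integral>\<^sup>+x. ennreal (\<bar>det (matrix (g' x))\<bar> * f (g x)) * indicator S x \<partial>lborel)" (is "?A = ?B")
proof -
  obtain e :: "'n ordered_index \<Rightarrow> 'n" where e: "bij e"
    using ordered_index_bij by blast
  have ee: "e (inv e x) = x" "inv e (e y) = y" for x y
    using e by (auto simp: bij_is_surj surj_f_inv_f bij_is_inj inv_f_f)
  \<comment> \<open>L and its inverse K permute coordinates between the two index types.\<close>
  define L where "L y = (\<chi> i. y $ inv e i)" for y :: "real^'n ordered_index"
  define K where "K x = (\<chi> a. x $ e a)" for x :: "real^'n"
  have LK [simp]: "L (K x) = x" "K (L y) = y" for x y by (auto simp: L_def K_def ee vec_eq_iff)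
  have lin: "linear L" "linear K" by (auto simp: linear_iff L_def K_def vec_eq_iff)
  have [measurable]: "L \<in> borel_measurable borel"
    using lin by (intro borel_measurable_continuous_onI linear_continuous_on) (simp add: linear_conv_bounded_linear)
  have transfer: "(\<integral>\<^sup>+x. F x \<partial>lborel) = (\<integral>\<^sup>+y. F (L y) \<partial>lborel)" if [measurable]: "F \<in> borel_measurable borel"
    for F :: "real^'n \<Rightarrow> ennreal"
    by (subst lborel_reindex[OF e], fold L_def, subst nn_integral_distr) auto
  let ?S = "K ` S" and ?g = "\<lambda>y. K (g (L y))" and ?g' = "\<lambda>y h. K (g' (L y) (L h))"
  have mS: "y \<in> ?S \<longleftrightarrow> L y \<in> S" for y by (metis LK image_iff)
  have mgS: "y \<in> ?g ` ?S \<longleftrightarrow> L y \<in> g ` S" for y by (auto simp: image_iff) (metis LK)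
  have iS: "indicator ?S y = indicator S (L y)" for y using mS by (simp add: indicator_def)
  have igS: "indicator (?g ` ?S) y = indicator (g ` S) (L y)" for y
    unfolding indicator_def mgS by simp
  have dt: "det (matrix (?g' y)) = det (matrix (g' (L y)))" for y
  proof -
    have Lax: "L (axis b 1) = axis (e b) 1" for b
      by (simp add: L_def axis_def vec_eq_iff) (metis ee)
    have "matrix (?g' y) = (\<chi> a b. matrix (g' (L y)) $ e a $ e b)"
      by (simp add: matrix_def vec_eq_iff K_def Lax)
    then show ?thesis using det_reindex[OF e] by simp
  qed
  have "?A = (\<integral>\<^sup>+y. ennreal (indicator (g ` S) y * f y) \<partial>lborel)"
    by (intro nn_integral_cong) (auto simp: indicator_def)
  also have "\<dots> = (\<integral>\<^sup>+y. ennreal (indicator (g ` S) (L y) * f (L y)) \<partial>lborel)"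
    using m1 by (intro transfer) auto
  also have "\<dots> = (\<integral>\<^sup>+y. ennreal (f (L y)) * indicator (?g ` ?S) y \<partial>lborel)"
    unfolding igS by (intro nn_integral_cong) (auto simp: indicator_def)
  also have "\<dots> = (\<integral>\<^sup>+y. ennreal (\<bar>det (matrix (?g' y))\<bar> * f (L (?g y))) * indicator ?S y \<partial>lborel)"
  proof (rule nn_integral_change_of_variables_wellorder)
    have "?S = L -` S \<inter> space borel" using mS by auto
    also have "\<dots> \<in> sets borel" using S by measurable
    finally show "?S \<in> sets borel" .
    show "(?g has_derivative ?g' y) (at y within ?S)" if "y \<in> ?S" for y
    proof -
      have 1: "(L has_derivative L) (at y within ?S)" "(K has_derivative K) (at (g (L y)) within g ` L ` ?S)"
        using lin by (auto intro!: linear_imp_has_derivative)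
      have "L ` ?S = S" by (auto simp: image_image)
      then have "(g has_derivative g' (L y)) (at (L y) within L ` ?S)"
        using der mS that by simp
      from has_derivative_in_compose[OF has_derivative_in_compose[OF 1(1) this]] 1(2)
      show ?thesis by (simp add: image_image)
    qed
    show "inj_on ?g ?S" using inj by (auto simp: inj_on_def) (metis LK(1))
    show "0 \<le> f (L y)" if "y \<in> ?g ` ?S" for y using that f mgS by blast
    show "(\<lambda>y. indicator (?g ` ?S) y * f (L y)) \<in> borel_measurable borel"
      unfolding igS using measurable_compose[OF _ m1, of L borel] by simp
    show "(\<lambda>y. indicator ?S y * (\<bar>det (matrix (?g' y))\<bar> * f (L (?g y)))) \<in> borel_measurable borel"
      unfolding iS dt using measurable_compose[OF _ m2, of L borel] by simp
  qed
  also have "\<dots> = (\<integral>\<^sup>+y. ennreal (indicator S (L y) * (\<bar>det (matrix (g' (L y)))\<bar> * f (g (L y)))) \<partial>lborel)"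
    unfolding iS dt by (intro nn_integral_cong) (auto simp: indicator_def)
  also have "\<dots> = (\<integral>\<^sup>+x. ennreal (indicator S x * (\<bar>det (matrix (g' x))\<bar> * f (g x))) \<partial>lborel)"
    using m2 by (intro transfer[symmetric]) auto
  also have "\<dots> = ?B"
    by (intro nn_integral_cong) (auto simp: indicator_def)
  finally show ?thesis .
qed

section \<open>The Riemannian measure\<close>

text \<open>
  The segment from the identity to \<open>M\<close> consists of positive definite, hence invertible, matrices. The
  determinant does not vanish along it and so keeps the sign that it has at the identity.
\<close>
lemma det_pos_of_positive_definite:
  fixes M :: "real^'n::finite^'n"
  assumes "\<And>w. w \<noteq> 0 \<Longrightarrow> 0 < w \<bullet> (M *v w)"
  shows "0 < det M"
proof (rule ccontr)
  assume neg: "\<not> 0 < det M"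
  define H where "H t = (1 - t) *\<^sub>R mat 1 + t *\<^sub>R M" for t :: real
  have nz: "det (H t) \<noteq> 0" if t: "0 \<le> t" "t \<le> 1" for t
  proof -
    have "w = 0" if "H t *v w = 0" for w
    proof (rule ccontr)
      assume w: "w \<noteq> 0"
      have "w \<bullet> (H t *v w) = (1 - t) * (w \<bullet> w) + t * (w \<bullet> (M *v w))"
        by (simp add: H_def matrix_vector_mult_add_rdistrib scaleR_matrix_vector_assoc[symmetric] inner_add_right)
      moreover have "0 < (1 - t) * (w \<bullet> w) + t * (w \<bullet> (M *v w))"
      proof (cases "t = 0")
        case False
        then show ?thesis using t assms[OF w] by (intro add_nonneg_pos mult_nonneg_nonneg mult_pos_pos) auto
      qed (use w in simp)
      ultimately show False using that by simp
    qed
    then have "\<exists>B. B ** H t = mat 1" by (auto simp: matrix_left_invertible_ker)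
    then show ?thesis
      using invertible_det_nz invertible_left_inverse by blast
  qed
  have "continuous_on {0..1} (\<lambda>t. det (H t))"
    unfolding det_def H_def by (intro continuous_intros)
  moreover have "H 0 = mat 1" "H 1 = M" by (simp_all add: H_def)
  ultimately have "\<exists>t\<ge>0. t \<le> 1 \<and> det (H t) = 0"
    using neg IVT2'[of "\<lambda>t. det (H t)" 1 0 0] by auto
  then show False using nz by blast
qed

lemma det_scaleR:
  fixes M :: "real^'n::finite^'n"
  shows "det (k *\<^sub>R M) = k ^ CARD('n) * det M"
proof -
  have "k *\<^sub>R M = (\<chi> i. k *s M $ i)" by (simp add: vec_eq_iff)
  then show ?thesis using det_rows_mul[of "\<lambda>_. k" "\<lambda>i. M $ i"] by (simp add: vec_lambda_eta)
qed

lemma chart_inv_chart: "is_chart c \<Longrightarrow> p \<in> fst c \<Longrightarrow> chart_inv c (snd c p) = p"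
  unfolding is_chart_def homeomorphism_def by blast

lemma chart_inv_in: "is_chart c \<Longrightarrow> x \<in> snd c ` fst c \<Longrightarrow> chart_inv c x \<in> fst c"
  unfolding is_chart_def homeomorphism_def by blast

lemma chart_chart_inv: "is_chart c \<Longrightarrow> x \<in> snd c ` fst c \<Longrightarrow> snd c (chart_inv c x) = x"
  unfolding is_chart_def homeomorphism_def by blast

lemma chart_image_iff:
  assumes "is_chart c" "B \<subseteq> fst c"
  shows "x \<in> snd c ` B \<longleftrightarrow> x \<in> snd c ` fst c \<and> chart_inv c x \<in> B"
proof
  assume "x \<in> snd c ` B"
  then show "x \<in> snd c ` fst c \<and> chart_inv c x \<in> B"
    using assms by (auto simp: chart_inv_chart subset_iff)
next
  assume "x \<in> snd c ` fst c \<and> chart_inv c x \<in> B"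
  then show "x \<in> snd c ` B"
    using chart_chart_inv[OF assms(1)] by (metis imageI)
qed

definition vol_density :: "('a, 'n::finite) metric \<Rightarrow> ('a, 'n) chart \<Rightarrow> real^'n \<Rightarrow> real" where
  "vol_density g c x = sqrt (det (g c (chart_inv c x)))"

text \<open>
  The inverse of the chart, extended by a constant in order to be a Borel function on the whole coordinate
  space.
\<close>
definition parametrization :: "('a, 'n::finite) chart \<Rightarrow> real^'n \<Rightarrow> 'a" where
  "parametrization c x = (if x \<in> snd c ` fst c then chart_inv c x else undefined)"

definition chart_vol :: "('a::t2_space, 'n::finite) metric \<Rightarrow> ('a, 'n) chart \<Rightarrow> 'a measure" where
  "chart_vol g c = distr (density lborel (\<lambda>x. ennreal (indicator (snd c ` fst c) x * vol_density g c x)))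
     borel (parametrization c)"

lemma sets_chart_vol [simp, measurable_cong]: "sets (chart_vol g c) = sets borel"
  by (simp add: chart_vol_def)

lemma chart_open: "is_chart c \<Longrightarrow> open (fst c)" "is_chart c \<Longrightarrow> open (snd c ` fst c)"
  by (auto simp: is_chart_def)

lemma measurable_parametrization:
  assumes "is_chart c" shows "parametrization c \<in> borel_measurable borel"
proof -
  have "continuous_on (snd c ` fst c) (chart_inv c)"
    using assms unfolding is_chart_def homeomorphism_def by blast
  then have "chart_inv c \<in> borel_measurable (restrict_space borel (snd c ` fst c))"
    by (rule borel_measurable_continuous_on_restrict)
  then show ?thesis
    unfolding parametrization_def[abs_def] using chart_open(2)[OF assms]
    by (subst (asm) measurable_restrict_space_iff[where c = undefined]) auto
qed

lemma chart_image_borel: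
  assumes "is_chart c" "B \<in> sets borel" "B \<subseteq> fst c"
  shows "snd c ` B \<in> sets borel"
proof -
  have "snd c ` B = parametrization c -` B \<inter> space borel \<inter> snd c ` fst c"
    unfolding set_eq_iff chart_image_iff[OF assms(1,3)] by (auto simp: parametrization_def)
  also have "\<dots> \<in> sets borel"
    using measurable_parametrization[OF assms(1)] assms(2) chart_open(2)[OF assms(1)]
    by (intro sets.Int measurable_sets) auto
  finally show ?thesis .
qed

lemma continuous_on_vol_density:
  assumes "riemannian_metric A g" "c \<in> A"
  shows "continuous_on (snd c ` fst c) (vol_density g c)"
proof -
  have "continuous_on (snd c ` fst c) (\<lambda>x. g c (chart_inv c x) $ i $ j)" for i j
    using assms unfolding riemannian_metric_def by (blast intro: smooth_on_continuous)
  then show ?thesis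
    unfolding vol_density_def[abs_def] det_def
    by (intro continuous_on_real_sqrt continuous_on_sum continuous_on_mult continuous_on_const continuous_on_prod)
qed

lemma riemannian_metric_positive_definite:
  assumes "riemannian_metric A g" "c \<in> A" "p \<in> fst c" "w \<noteq> 0"
  shows "0 < w \<bullet> (g c p *v w)"
  using assms unfolding riemannian_metric_def by blast

lemma vol_density_pos:
  assumes "riemannian_metric A g" "c \<in> A" "is_chart c" "x \<in> snd c ` fst c"
  shows "0 < vol_density g c x"
  unfolding vol_density_def
  using det_pos_of_positive_definite riemannian_metric_positive_definite[OF assms(1,2) chart_inv_in[OF assms(3,4)]]
  by auto

lemma measurable_vol_density:
  assumes "riemannian_metric A g" "c \<in> A" "is_chart c"
  shows "(\<lambda>x. indicator (snd c ` fst c) x * vol_density g c x) \<in> borel_measurable borel"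
  using borel_measurable_continuous_on_indicator[OF _ continuous_on_vol_density[OF assms(1,2)]]
    chart_open(2)[OF assms(3)] by (simp add: borel_open)

lemma nn_integral_chart_vol:
  assumes "riemannian_metric A g" "c \<in> A" "is_chart c" and F: "F \<in> borel_measurable borel"
  shows "(\<integral>\<^sup>+p. F p \<partial>chart_vol g c)
    = (\<integral>\<^sup>+x. ennreal (vol_density g c x) * F (chart_inv c x) * indicator (snd c ` fst c) x \<partial>lborel)"
proof -
  note [measurable] = F measurable_parametrization[OF assms(3)]
    measurable_compose[OF measurable_vol_density[OF assms(1-3)] measurable_ennreal]
  show ?thesis
    unfolding chart_vol_def
    by (subst nn_integral_distr, simp, simp, subst nn_integral_density, simp, simp)
      (intro nn_integral_cong, auto simp: indicator_def parametrization_def)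
qed

lemma emeasure_chart_vol:
  assumes "riemannian_metric A g" "c \<in> A" "is_chart c" "B \<in> sets borel" "B \<subseteq> fst c"
  shows "emeasure (chart_vol g c) B = (\<integral>\<^sup>+x. ennreal (vol_density g c x) * indicator (snd c ` B) x \<partial>lborel)"
proof -
  have "emeasure (chart_vol g c) B = (\<integral>\<^sup>+p. indicator B p \<partial>chart_vol g c)"
    using assms(4) by simp
  also have "\<dots> = (\<integral>\<^sup>+x. ennreal (vol_density g c x) * indicator B (chart_inv c x) * indicator (snd c ` fst c) x \<partial>lborel)"
    using assms by (intro nn_integral_chart_vol) auto
  also have "\<dots> = (\<integral>\<^sup>+x. ennreal (vol_density g c x) * indicator (snd c ` B) x \<partial>lborel)"
    by (intro nn_integral_cong) (simp add: indicator_def chart_image_iff[OF assms(3,5)], blast)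
  finally show ?thesis .
qed

lemma emeasure_chart_vol_Int:
  assumes "riemannian_metric A g" "c \<in> A" "is_chart c" "B \<in> sets borel"
  shows "emeasure (chart_vol g c) (B \<inter> fst c) = emeasure (chart_vol g c) B"
proof -
  have "open (fst c)" using assms(3) by (simp add: is_chart_def)
  have "emeasure (chart_vol g c) C = (\<integral>\<^sup>+x. ennreal (vol_density g c x) * indicator C (chart_inv c x) * indicator (snd c ` fst c) x \<partial>lborel)"
    if "C \<in> sets borel" for C
    using nn_integral_chart_vol[OF assms(1-3), of "indicator C"] that by simp
  note this[of B] this[of "B \<inter> fst c"]
  moreover have "(\<integral>\<^sup>+x. ennreal (vol_density g c x) * indicator (B \<inter> fst c) (chart_inv c x) * indicator (snd c ` fst c) x \<partial>lborel)
    = (\<integral>\<^sup>+x. ennreal (vol_density g c x) * indicator B (chart_inv c x) * indicator (snd c ` fst c) x \<partial>lborel)"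
    by (intro nn_integral_cong) (use chart_inv_in[OF assms(3)] in \<open>simp add: indicator_def\<close>)
  ultimately show ?thesis using assms(4) \<open>open (fst c)\<close> by simp
qed

text \<open>
  The transformation law of the metric gives \<open>det g = (det J)^2 * det g'\<close> with the Jacobian \<open>J\<close> of the
  transition map, so the volume densities of two charts differ by exactly the factor \<open>\<bar>det J\<bar>\<close> of the
  change of variables formula.
\<close>
lemma chart_vol_overlap:
  assumes At: "smooth_atlas A" and R: "riemannian_metric A g" and c: "c \<in> A" and d: "d \<in> A"
    and B: "B \<in> sets borel" "B \<subseteq> fst c" "B \<subseteq> fst d"
  shows "emeasure (chart_vol g c) B = emeasure (chart_vol g d) B"
proof -
  have cc: "is_chart c" and dc: "is_chart d" using At c d by (auto simp: smooth_atlas_def)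
  let ?T = "transition c d"
  define T' where "T' x = frechet_derivative ?T (at x)" for x
  have Tp: "?T (snd c p) = snd d p" if "p \<in> B" for p
    using that B cc by (simp add: transition_def chart_inv_chart subset_iff)
  have TS: "?T ` snd c ` B = snd d ` B" using Tp by (force simp: image_image)
  have rho: "vol_density g c (snd c p) = \<bar>det (matrix (T' (snd c p)))\<bar> * vol_density g d (?T (snd c p))"
    if "p \<in> B" for p
  proof -
    have p: "p \<in> fst c" "p \<in> fst d" using that B by auto
    have "g c p = transpose (jacobian c d p) ** g d p ** jacobian c d p"
      using R c d p unfolding riemannian_metric_def by blast
    then have "det (g c p) = (det (jacobian c d p))\<^sup>2 * det (g d p)"
      by (simp add: det_mul det_transpose power2_eq_square)
    then show ?thesis
      using p by (simp add: vol_density_def Tp[OF that] chart_inv_chart cc dc real_sqrt_mult jacobian_def T'_def)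
  qed
  have "emeasure (chart_vol g d) B = (\<integral>\<^sup>+y. ennreal (vol_density g d y) * indicator (?T ` snd c ` B) y \<partial>lborel)"
    unfolding TS by (rule emeasure_chart_vol[OF R d dc B(1,3)])
  also have "\<dots> = (\<integral>\<^sup>+x. ennreal (\<bar>det (matrix (T' x))\<bar> * vol_density g d (?T x)) * indicator (snd c ` B) x \<partial>lborel)"
  proof (rule nn_integral_change_of_variables)
    show "snd c ` B \<in> sets borel" by (rule chart_image_borel[OF cc B(1,2)])
    show "(?T has_derivative T' x) (at x within snd c ` B)" if "x \<in> snd c ` B" for x
    proof -
      have "x \<in> snd c ` (fst c \<inter> fst d)" using that B by auto
      then have "(\<lambda>x. ?T x $ i) differentiable (at x)" for i
        using At c d unfolding smooth_atlas_def by (blast intro: smooth_on_differentiable)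
      then have "?T differentiable (at x)"
        by (subst differentiable_componentwise_within) (auto simp: Basis_vec_def inner_axis)
      then show ?thesis
        unfolding T'_def by (simp add: frechet_derivative_works has_derivative_at_withinI)
    qed
    show "inj_on ?T (snd c ` B)"
      using B dc by (auto intro!: inj_onI simp: Tp) (metis chart_inv_chart subsetD)
    show "0 \<le> vol_density g d y" if "y \<in> ?T ` snd c ` B" for y
      using that B vol_density_pos[OF R d dc] unfolding TS by (meson image_mono less_imp_le subsetD)
    have dB: "snd d ` B \<in> sets borel" by (rule chart_image_borel[OF dc B(1,3)])
    have cB: "snd c ` B \<in> sets borel" by (rule chart_image_borel[OF cc B(1,2)])
    have "(\<lambda>y. indicator (snd d ` B) y * (indicator (snd d ` fst d) y * vol_density g d y)) \<in> borel_measurable borel"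
      using dB measurable_vol_density[OF R d dc] by measurable
    also have "(\<lambda>y. indicator (snd d ` B) y * (indicator (snd d ` fst d) y * vol_density g d y))
        = (\<lambda>y. indicator (snd d ` B) y * vol_density g d y)"
      using B(3) by (auto simp: fun_eq_iff indicator_def)
    finally show "(\<lambda>y. indicator (?T ` snd c ` B) y * vol_density g d y) \<in> borel_measurable borel"
      unfolding TS .
    have "(\<lambda>x. indicator (snd c ` B) x * (indicator (snd c ` fst c) x * vol_density g c x)) \<in> borel_measurable borel"
      using cB measurable_vol_density[OF R c cc] by measurable
    also have "(\<lambda>x. indicator (snd c ` B) x * (indicator (snd c ` fst c) x * vol_density g c x))
        = (\<lambda>x. indicator (snd c ` B) x * (\<bar>det (matrix (T' x))\<bar> * vol_density g d (?T x)))"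
      using B(2) rho by (auto simp: fun_eq_iff indicator_def)
    finally show "(\<lambda>x. indicator (snd c ` B) x * (\<bar>det (matrix (T' x))\<bar> * vol_density g d (?T x))) \<in> borel_measurable borel" .
  qed
  also have "\<dots> = (\<integral>\<^sup>+x. ennreal (vol_density g c x) * indicator (snd c ` B) x \<partial>lborel)"
    by (intro nn_integral_cong) (use rho in \<open>auto simp: indicator_def\<close>)
  also have "\<dots> = emeasure (chart_vol g c) B"
    by (rule emeasure_chart_vol[OF R c cc B(1,2), symmetric])
  finally show ?thesis by simp
qed

text \<open>
  Finitely many charts cover a compact manifold. Removing from each chart domain the earlier ones
  leaves Borel pieces on which a measure can be computed chart by chart.
\<close>
lemma chart_partition:
  assumes "compact (UNIV :: 'a::t2_space set)" "smooth_atlas (A :: ('a, 'n::finite) chart set)"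
  obtains C D where "finite C" "C \<subseteq> A" "disjoint_family_on D C" "(\<Union>c\<in>C. D c) = UNIV"
    "\<And>c. c \<in> C \<Longrightarrow> D c \<in> sets borel" "\<And>c. c \<in> C \<Longrightarrow> D c \<subseteq> fst c"
proof -
  have op: "open (fst c)" if "c \<in> A" for c
    using assms(2) that by (simp add: smooth_atlas_def is_chart_def)
  obtain C where C: "C \<subseteq> A" "finite C" "UNIV \<subseteq> (\<Union>c\<in>C. fst c)"
  proof (rule compactE_image[OF assms(1)])
    show "UNIV \<subseteq> (\<Union>c\<in>A. fst c)" using assms(2) by (simp add: smooth_atlas_def)
  qed (use op in auto)
  have "\<exists>D. disjoint_family_on D C \<and> (\<Union>c\<in>C. D c) = (\<Union>c\<in>C. fst c) \<and>
      (\<forall>c\<in>C. D c \<in> sets borel \<and> D c \<subseteq> fst c)"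
    using C(2,1)
  proof (induction rule: finite_induct)
    case empty
    then show ?case by (simp add: disjoint_family_on_def)
  next
    case (insert d F)
    then obtain D where D: "disjoint_family_on D F" "(\<Union>c\<in>F. D c) = (\<Union>c\<in>F. fst c)"
        "\<forall>c\<in>F. D c \<in> sets borel \<and> D c \<subseteq> fst c" by blast
    define D' where "D' = D(d := fst d - (\<Union>c\<in>F. fst c))"
    have D'F: "D' c = D c" if "c \<in> F" for c using that insert.hyps by (auto simp: D'_def)
    have "disjoint_family_on D' (insert d F)"
      using D(1) D(2) D'F insert.hyps unfolding disjoint_family_on_insert[OF insert.hyps(2)]
      by (auto simp: disjoint_family_on_def D'_def)
    moreover have "(\<Union>c\<in>insert d F. D' c) = (\<Union>c\<in>insert d F. fst c)"
    proof -
      have "(\<Union>c\<in>F. D' c) = (\<Union>c\<in>F. fst c)" using D'F D(2) by simp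
      then show ?thesis by (auto simp: D'_def)
    qed
    moreover have "open (\<Union>c\<in>F. fst c)" "open (fst d)"
      using op insert.prems by (blast intro: open_UN)+
    then have "D' d \<in> sets borel" "D' d \<subseteq> fst d" by (auto simp: D'_def)
    then have "\<forall>c\<in>insert d F. D' c \<in> sets borel \<and> D' c \<subseteq> fst c"
      using D(3) D'F by simp
    ultimately show ?case by blast
  qed
  then show thesis using C that by (metis top.extremum_uniqueI)
qed

text \<open>
  A measure is the sum of its restrictions to the pieces of a chart partition; this gives the uniqueness
  of the Riemannian measure.
\<close>
lemma measure_eqI_charts:
  assumes "compact (UNIV :: 'a::t2_space set)" "smooth_atlas (A :: ('a, 'n::finite) chart set)"
    and sets: "sets \<mu> = sets borel" "sets \<nu> = sets borel"
    and eq: "\<And>c B. c \<in> A \<Longrightarrow> B \<in> sets borel \<Longrightarrow> B \<subseteq> fst c \<Longrightarrow> emeasure \<mu> B = emeasure \<nu> B"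
  shows "\<mu> = \<nu>"
proof (rule measure_eqI)
  show "sets \<mu> = sets \<nu>" using sets by simp
  fix B assume "B \<in> sets \<mu>"
  then have B: "B \<in> sets borel" using sets by simp
  obtain C D where CD: "finite C" "C \<subseteq> A" "disjoint_family_on D C" "(\<Union>c\<in>C. D c) = UNIV"
    "\<And>c. c \<in> C \<Longrightarrow> D c \<in> sets borel" "\<And>c. c \<in> C \<Longrightarrow> D c \<subseteq> fst c"
    by (rule chart_partition[OF assms(1,2)]) blast
  have "emeasure M B = (\<Sum>c\<in>C. emeasure M (B \<inter> D c))" if "sets M = sets borel" for M
    using CD B that by (intro sum_emeasure_cover) auto
  moreover have "emeasure \<mu> (B \<inter> D c) = emeasure \<nu> (B \<inter> D c)" if "c \<in> C" for c
  proof (rule eq)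
    show "c \<in> A" using that CD(2) by blast
    show "B \<inter> D c \<in> sets borel" using B CD(5)[OF that] by simp
    show "B \<inter> D c \<subseteq> fst c" using CD(6)[OF that] by blast
  qed
  ultimately show "emeasure \<mu> B = emeasure \<nu> B" using sets by simp
qed

text \<open>
  The property that characterises \<open>vol A g\<close>.
\<close>
definition riemannian_volume ::
    "('a::t2_space, 'n::finite) chart set \<Rightarrow> ('a, 'n) metric \<Rightarrow> 'a measure \<Rightarrow> bool" where
  "riemannian_volume A g \<mu> \<longleftrightarrow> sets \<mu> = sets borel \<and>
     (\<forall>c\<in>A. \<forall>B\<in>sets borel. B \<subseteq> fst c \<longrightarrow>
        emeasure \<mu> B = (\<integral>\<^sup>+x. ennreal (vol_density g c x) * indicator (snd c ` B) x \<partial>lborel))"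

lemma vol_eqI:
  assumes "compact (UNIV :: 'a::t2_space set)" "smooth_atlas (A :: ('a, 'n::finite) chart set)"
    "riemannian_volume A g \<mu>"
  shows "vol A g = \<mu>"
  unfolding vol_def vol_density_def[symmetric] riemannian_volume_def[symmetric]
proof (rule the_equality)
  fix \<nu> assume "riemannian_volume A g \<nu>"
  then show "\<nu> = \<mu>"
    using assms(3) unfolding riemannian_volume_def
    by (intro measure_eqI_charts[OF assms(1,2)]) auto
qed fact

text \<open>
  The chart measures are glued along a chart partition. On a set inside an arbitrary chart \<open>d\<close> the result is
  the chart measure of \<open>d\<close>, because each piece may be computed in \<open>d\<close> instead of its own chart.
\<close>
lemma riemannian_volume_exists:
  assumes "compact (UNIV :: 'a::t2_space set)" and At: "smooth_atlas (A :: ('a, 'n::finite) chart set)"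
    and R: "riemannian_metric A g"
  shows "\<exists>\<mu>. riemannian_volume A g \<mu>"
proof -
  have ch: "is_chart c" if "c \<in> A" for c using At that by (simp add: smooth_atlas_def)
  obtain C D where CD: "finite C" "C \<subseteq> A" "disjoint_family_on D C" "(\<Union>c\<in>C. D c) = UNIV"
    "\<And>c. c \<in> C \<Longrightarrow> D c \<in> sets borel" "\<And>c. c \<in> C \<Longrightarrow> D c \<subseteq> fst c"
    by (rule chart_partition[OF assms(1,2)]) blast
  define \<mu> where "\<mu> = measure_of UNIV (sets borel) (\<lambda>B. \<Sum>c\<in>C. emeasure (chart_vol g c) (B \<inter> D c))"
  have sets: "sets \<mu> = sets borel"
    using sets.sigma_sets_eq[of "borel :: 'a measure"] by (simp add: \<mu>_def)
  have em: "emeasure \<mu> B = (\<Sum>c\<in>C. emeasure (chart_vol g c) (B \<inter> D c))" if "B \<in> sets borel" for B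
  proof (rule emeasure_measure_of[OF \<mu>_def])
    show "countably_additive (sets \<mu>) (\<lambda>B. \<Sum>c\<in>C. emeasure (chart_vol g c) (B \<inter> D c))"
    proof (rule countably_additiveI)
      fix F :: "nat \<Rightarrow> 'a set" assume F: "range F \<subseteq> sets \<mu>" "disjoint_family F"
      have "(\<Sum>i. \<Sum>c\<in>C. emeasure (chart_vol g c) (F i \<inter> D c)) = (\<Sum>c\<in>C. \<Sum>i. emeasure (chart_vol g c) (F i \<inter> D c))"
        by (rule suminf_sum) (rule summableI)
      also have "\<dots> = (\<Sum>c\<in>C. emeasure (chart_vol g c) (\<Union>i. F i \<inter> D c))"
      proof (intro sum.cong suminf_emeasure refl)
        fix c assume c: "c \<in> C"
        show "range (\<lambda>i. F i \<inter> D c) \<subseteq> sets (chart_vol g c)"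
          using F(1) CD(5)[OF c] by (auto simp: sets)
        show "disjoint_family (\<lambda>i. F i \<inter> D c)"
          using F(2) unfolding disjoint_family_on_def by blast
      qed
      finally show "(\<Sum>i. \<Sum>c\<in>C. emeasure (chart_vol g c) (F i \<inter> D c)) =
          (\<Sum>c\<in>C. emeasure (chart_vol g c) (\<Union> (range F) \<inter> D c))"
        by (simp only: UN_simps(4))
    qed
    show "B \<in> sets \<mu>" using that by (simp add: sets)
  qed (simp_all add: positive_def)
  have "emeasure \<mu> B = emeasure (chart_vol g d) B" if d: "d \<in> A" and B: "B \<in> sets borel" "B \<subseteq> fst d" for d B
  proof -
    have "emeasure \<mu> B = (\<Sum>c\<in>C. emeasure (chart_vol g d) (B \<inter> D c))"
      unfolding em[OF B(1)]
    proof (intro sum.cong refl)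
      fix c assume c: "c \<in> C"
      show "emeasure (chart_vol g c) (B \<inter> D c) = emeasure (chart_vol g d) (B \<inter> D c)"
      proof (rule chart_vol_overlap[OF At R _ d])
        show "c \<in> A" using c CD(2) by blast
        show "B \<inter> D c \<in> sets borel" using B CD(5)[OF c] by simp
        show "B \<inter> D c \<subseteq> fst c" using CD(6)[OF c] by blast
        show "B \<inter> D c \<subseteq> fst d" using B(2) by blast
      qed
    qed
    also have "\<dots> = emeasure (chart_vol g d) B"
      using CD(1,3,4,5) B(1) by (intro sum_emeasure_cover[symmetric]) auto
    finally show ?thesis .
  qed
  then have "emeasure \<mu> B = (\<integral>\<^sup>+x. ennreal (vol_density g d x) * indicator (snd d ` B) x \<partial>lborel)"
    if "d \<in> A" "B \<in> sets borel" "B \<subseteq> fst d" for d B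
    using emeasure_chart_vol[OF R that(1) ch[OF that(1)] that(2,3)] that by simp
  then have "riemannian_volume A g \<mu>"
    unfolding riemannian_volume_def using sets by blast
  then show ?thesis ..
qed

lemma riemannian_volume_vol:
  assumes "compact (UNIV :: 'a::t2_space set)" "smooth_atlas (A :: ('a, 'n::finite) chart set)"
    "riemannian_metric A g"
  shows "riemannian_volume A g (vol A g)"
  using riemannian_volume_exists[OF assms] vol_eqI[OF assms(1,2)] by metis

context
  fixes A :: "('a::t2_space, 'n::finite) chart set" and g :: "('a, 'n) metric"
  assumes cpt: "compact (UNIV :: 'a set)" and At: "smooth_atlas A" and R: "riemannian_metric A g"
begin

lemma sets_vol: "sets (vol A g) = sets borel"
  using riemannian_volume_vol[OF cpt At R] by (simp add: riemannian_volume_def)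

lemma space_vol: "space (vol A g) = UNIV"
  using sets_eq_imp_space_eq[OF sets_vol] by simp

lemma atlas_chart: "c \<in> A \<Longrightarrow> is_chart c"
  using At by (simp add: smooth_atlas_def)

lemma emeasure_vol:
  "c \<in> A \<Longrightarrow> B \<in> sets borel \<Longrightarrow> B \<subseteq> fst c \<Longrightarrow> emeasure (vol A g) B = emeasure (chart_vol g c) B"
  using riemannian_volume_vol[OF cpt At R] emeasure_chart_vol[OF R _ atlas_chart]
  by (simp add: riemannian_volume_def)

text \<open>
  This reduces integrals with respect to \<open>vol A g\<close> over a subset of a chart domain to integrals over
  coordinates.
\<close>
lemma density_vol_chart:
  assumes c: "c \<in> A"
  shows "density (vol A g) (indicator (fst c)) = chart_vol g c"
proof (rule measure_eqI)
  show "sets (density (vol A g) (indicator (fst c))) = sets (chart_vol g c)" by (simp add: sets_vol)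
  fix B assume "B \<in> sets (density (vol A g) (indicator (fst c)))"
  then have B: "B \<in> sets borel" by (simp add: sets_vol)
  have U: "fst c \<in> sets borel" using chart_open(1)[OF atlas_chart[OF c]] by simp
  have "emeasure (density (vol A g) (indicator (fst c))) B = (\<integral>\<^sup>+p. indicator (fst c) p * indicator B p \<partial>vol A g)"
    using B U by (intro emeasure_density) (simp_all add: sets_vol measurable_cong_sets[OF sets_vol refl])
  also have "\<dots> = (\<integral>\<^sup>+p. indicator (B \<inter> fst c) p \<partial>vol A g)"
    by (intro nn_integral_cong) (auto simp: indicator_def)
  also have "\<dots> = emeasure (vol A g) (B \<inter> fst c)" using B U by (simp add: sets_vol)
  also have "\<dots> = emeasure (chart_vol g c) (B \<inter> fst c)" using B U by (intro emeasure_vol c) auto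
  finally show "emeasure (density (vol A g) (indicator (fst c))) B = emeasure (chart_vol g c) B"
    using emeasure_chart_vol_Int[OF R c atlas_chart[OF c] B] by simp
qed

text \<open>
  In every chart the determinant of the metric is multiplied by \<open>u^(-2n)\<close>, so the measure with density
  \<open>u^(-n)\<close> has the characterising property of the volume of the new metric, and uniqueness applies.
\<close>
lemma vol_conf_metric:
  assumes u: "u \<in> borel_measurable borel" "\<And>p. 0 < u p"
  shows "vol A (conf_metric u g) = density (vol A g) (\<lambda>p. ennreal (inverse (u p) ^ CARD('n)))"
proof (rule vol_eqI[OF cpt At], unfold riemannian_volume_def, intro conjI ballI impI)
  let ?w = "\<lambda>p. ennreal (inverse (u p) ^ CARD('n))"
  show "sets (density (vol A g) ?w) = sets borel" by (simp add: sets_vol)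
  fix c B assume c: "c \<in> A" and B: "B \<in> sets (borel :: 'a measure)" "B \<subseteq> fst c"
  note ch = atlas_chart[OF c]
  have [measurable]: "u \<in> borel_measurable (vol A g)" "u \<in> borel_measurable borel" "fst c \<in> sets (vol A g)" "B \<in> sets (vol A g)"
      "B \<in> sets borel"
    using u B chart_open(1)[OF ch] by (simp_all add: sets_vol measurable_cong_sets[OF sets_vol refl])
  have "emeasure (density (vol A g) ?w) B = (\<integral>\<^sup>+p. ?w p * indicator B p \<partial>vol A g)"
    by (intro emeasure_density) auto
  also have "\<dots> = (\<integral>\<^sup>+p. indicator (fst c) p * (?w p * indicator B p) \<partial>vol A g)"
    using B(2) by (intro nn_integral_cong) (auto simp: indicator_def)
  also have "\<dots> = (\<integral>\<^sup>+p. ?w p * indicator B p \<partial>density (vol A g) (indicator (fst c)))"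
    by (subst nn_integral_density) auto
  also have "\<dots> = (\<integral>\<^sup>+x. ennreal (vol_density g c x) * (?w (chart_inv c x) * indicator B (chart_inv c x)) * indicator (snd c ` fst c) x \<partial>lborel)"
    unfolding density_vol_chart[OF c] by (intro nn_integral_chart_vol[OF R c ch]) measurable
  also have "\<dots> = (\<integral>\<^sup>+x. ennreal (vol_density (conf_metric u g) c x) * indicator (snd c ` B) x \<partial>lborel)"
  proof (intro nn_integral_cong)
    fix x
    have "vol_density (conf_metric u g) c x = vol_density g c x * inverse (u (chart_inv c x)) ^ CARD('n)"
      using u(2)[of "chart_inv c x"]
      by (simp add: vol_density_def conf_metric_def det_scaleR real_sqrt_mult real_sqrt_power real_sqrt_inverse)
    moreover have "x \<in> snd c ` B \<Longrightarrow> 0 \<le> vol_density g c x"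
      using vol_density_pos[OF R c ch, of x] B(2) by force
    ultimately show "ennreal (vol_density g c x) * (?w (chart_inv c x) * indicator B (chart_inv c x)) * indicator (snd c ` fst c) x
      = ennreal (vol_density (conf_metric u g) c x) * indicator (snd c ` B) x"
      using chart_image_iff[OF ch B(2), of x] u(2)[of "chart_inv c x"]
      by (cases "x \<in> snd c ` B") (auto simp: indicator_def ennreal_mult)
  qed
  finally show "emeasure (density (vol A g) ?w) B = (\<integral>\<^sup>+x. ennreal (vol_density (conf_metric u g) c x) * indicator (snd c ` B) x \<partial>lborel)" .
qed

text \<open>
  Each point has a neighbourhood that is a coordinate ball with compact closure inside the chart image. The
  volume density is bounded there, and finitely many such neighbourhoods cover the manifold.
\<close>
lemma finite_vol: "emeasure (vol A g) UNIV < \<infinity>"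
proof -
  have ex: "\<exists>W. open W \<and> p \<in> W \<and> emeasure (vol A g) W < \<infinity>" for p
  proof -
    have "p \<in> (\<Union>c\<in>A. fst c)" using At by (simp add: smooth_atlas_def)
    then obtain c where c: "c \<in> A" "p \<in> fst c" by blast
    note ch = atlas_chart[OF c(1)]
    obtain e where e: "0 < e" "cball (snd c p) e \<subseteq> snd c ` fst c"
      using chart_open(2)[OF ch] c(2) open_contains_cball by blast
    define W where "W = fst c \<inter> snd c -` ball (snd c p) e"
    have "continuous_on (fst c) (snd c)"
      using ch unfolding is_chart_def homeomorphism_def by blast
    then have W: "open W" unfolding W_def using chart_open(1)[OF ch] by (intro continuous_open_preimage) auto
    have "compact (vol_density g c ` cball (snd c p) e)"
      using continuous_on_subset[OF continuous_on_vol_density[OF R c(1)] e(2)]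
      by (intro compact_continuous_image) auto
    then obtain b where b: "\<And>x. x \<in> cball (snd c p) e \<Longrightarrow> \<bar>vol_density g c x\<bar> \<le> b"
      by (force dest!: compact_imp_bounded simp: bounded_iff)
    have "emeasure (vol A g) W = (\<integral>\<^sup>+x. ennreal (vol_density g c x) * indicator (snd c ` W) x \<partial>lborel)"
      using emeasure_vol[OF c(1), of W] emeasure_chart_vol[OF R c(1) ch, of W] W by (simp add: W_def)
    also have "\<dots> \<le> (\<integral>\<^sup>+x. ennreal b * indicator (cball (snd c p) e) x \<partial>lborel)"
    proof (intro nn_integral_mono)
      fix x
      have "ennreal (vol_density g c x) \<le> ennreal b" if "x \<in> cball (snd c p) e"
        using b[OF that] by (intro ennreal_leI) linarith
      then show "ennreal (vol_density g c x) * indicator (snd c ` W) x \<le> ennreal b * indicator (cball (snd c p) e) x"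
        by (auto simp: indicator_def W_def)
    qed
    also have "\<dots> = ennreal b * emeasure lborel (cball (snd c p) e)"
      by (subst nn_integral_cmult_indicator) auto
    also have "\<dots> < \<infinity>"
      using emeasure_bounded_finite[of "cball (snd c p) e"] by (simp add: ennreal_mult_less_top)
    finally show ?thesis using W c(2) e(1) by (intro exI[of _ W]) (simp add: W_def)
  qed
  then obtain W where W: "\<And>p. open (W p)" "\<And>p. p \<in> W p" "\<And>p. emeasure (vol A g) (W p) < \<infinity>"
    by metis
  obtain C where C: "finite C" "UNIV \<subseteq> (\<Union>p\<in>C. W p)"
    by (rule compactE_image[OF cpt, of UNIV W]) (use W in auto)
  then have "UNIV = (\<Union>p\<in>C. W p)" by blast
  then have "emeasure (vol A g) UNIV \<le> (\<Sum>p\<in>C. emeasure (vol A g) (W p))"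
    using emeasure_subadditive_finite[OF C(1), of W "vol A g"] W(1) by (simp add: sets_vol image_subset_iff)
  also have "\<dots> < \<infinity>" using W(3) C(1) by simp
  finally show ?thesis .
qed

text \<open>
  A chart image is a nonempty open set, which is not negligible, and the volume density is positive on it.
\<close>
lemma vol_pos: "emeasure (vol A g) UNIV \<noteq> 0"
proof
  assume 0: "emeasure (vol A g) UNIV = 0"
  have "undefined \<in> (\<Union>c\<in>A. fst c)" using At by (simp add: smooth_atlas_def)
  then obtain c where c: "c \<in> A" "undefined \<in> fst c" by blast
  note ch = atlas_chart[OF c(1)]
  let ?S = "snd c ` fst c"
  have U: "fst c \<in> sets borel" using chart_open(1)[OF ch] by simp
  have "emeasure (vol A g) (fst c) = 0"
    using emeasure_mono[of "fst c" UNIV "vol A g"] 0 by (simp add: sets_vol)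
  then have "(\<integral>\<^sup>+x. ennreal (vol_density g c x) * indicator ?S x \<partial>lborel) = 0"
    using emeasure_vol[OF c(1) U] emeasure_chart_vol[OF R c(1) ch U] by simp
  also have "(\<integral>\<^sup>+x. ennreal (vol_density g c x) * indicator ?S x \<partial>lborel)
      = (\<integral>\<^sup>+x. ennreal (indicator ?S x * vol_density g c x) \<partial>lborel)"
    by (intro nn_integral_cong) (simp add: indicator_def)
  finally have "AE x in lborel. ennreal (indicator ?S x * vol_density g c x) = 0"
    using measurable_vol_density[OF R c(1) ch] by (subst (asm) nn_integral_0_iff_AE) auto
  then have "AE x in lborel. x \<notin> ?S"
  proof eventually_elim
    case (elim x)
    show "x \<notin> ?S"
    proof
      assume "x \<in> ?S"
      then show False using elim vol_density_pos[OF R c(1) ch \<open>x \<in> ?S\<close>] by (simp add: ennreal_eq_0_iff)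
    qed
  qed
  moreover have op: "open ?S" using chart_open(2)[OF ch] .
  ultimately have "?S \<in> null_sets lborel"
    by (subst AE_iff_null_sets) auto
  then have "negligible ?S" by (simp add: negligible_iff_null_sets null_sets_completionI)
  then show False using open_not_negligible[OF op] c(2) by blast
qed

lemma measurable_vol_of_continuous:
  fixes f :: "'a \<Rightarrow> real"
  assumes "continuous_on UNIV f"
  shows "f \<in> borel_measurable (vol A g)"
  using borel_measurable_continuous_onI[OF assms] by (simp add: measurable_cong_sets[OF sets_vol refl])

lemma integrable_vol_of_continuous:
  fixes f :: "'a \<Rightarrow> real"
  assumes "continuous_on UNIV f"
  shows "integrable (vol A g) f"
proof -
  interpret finite_measure "vol A g"
    using finite_vol by (intro finite_measureI) (simp add: space_vol)
  have "compact (range f)" by (rule compact_continuous_image[OF assms cpt])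
  then obtain b where "\<And>p. \<bar>f p\<bar> \<le> b" by (force dest!: compact_imp_bounded simp: bounded_iff)
  then show ?thesis
    using measurable_vol_of_continuous[OF assms] by (intro integrable_const_bound[where B = b]) auto
qed

lemma integral_vol_pos:
  fixes f :: "'a \<Rightarrow> real"
  assumes "continuous_on UNIV f" "\<And>p. 0 < f p"
  shows "0 < (\<integral>p. f p \<partial>vol A g)"
proof -
  have "(\<integral>p. f p \<partial>vol A g) \<noteq> 0"
  proof
    assume "(\<integral>p. f p \<partial>vol A g) = 0"
    then have "AE p in vol A g. f p = 0"
      using integral_nonneg_eq_0_iff_AE[OF integrable_vol_of_continuous[OF assms(1)]] assms(2) by (simp add: less_imp_le)
    then have "AE p in vol A g. False"
    proof eventually_elim
      case (elim p)
      then show False using assms(2)[of p] by simp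
    qed
    then show False using vol_pos by (simp add: eventually_False ae_filter_eq_bot_iff space_vol)
  qed
  moreover have "0 \<le> (\<integral>p. f p \<partial>vol A g)" using assms(2) by (simp add: less_imp_le)
  ultimately show ?thesis by simp
qed

end

section \<open>The functionals on a conformal class\<close>

lemma smooth_fun_continuous:
  fixes A :: "('a::t2_space, 'n::finite) chart set"
  assumes At: "smooth_atlas A" and f: "smooth_fun A f"
  shows "continuous_on UNIV f"
proof -
  have "continuous_on (fst c) f" if c: "c \<in> A" for c
  proof -
    have ch: "is_chart c" using At c by (simp add: smooth_atlas_def)
    have "continuous_on (snd c ` fst c) (\<lambda>x. f (chart_inv c x))"
      using f c unfolding smooth_fun_def by (blast intro: smooth_on_continuous)
    moreover have "continuous_on (fst c) (snd c)"
      using ch unfolding is_chart_def homeomorphism_def by blast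
    ultimately have "continuous_on (fst c) (\<lambda>p. f (chart_inv c (snd c p)))"
      by (rule continuous_on_compose2) simp
    then show ?thesis
      by (rule continuous_on_eq) (simp add: chart_inv_chart[OF ch])
  qed
  then have "continuous_on (\<Union>c\<in>A. fst c) f"
    using At by (intro continuous_on_open_UN) (auto simp: smooth_atlas_def is_chart_def)
  then show ?thesis using At by (simp add: smooth_atlas_def)
qed

lemma pos_smooth_cmult:
  assumes "smooth_atlas A" "u \<in> pos_smooth A" "0 < c"
  shows "(\<lambda>p. c * u p) \<in> pos_smooth A"
  unfolding pos_smooth_def smooth_fun_def smooth_on_def mem_Collect_eq
proof (intro conjI ballI allI)
  fix d k assume d: "d \<in> A"
  have "open (snd d ` fst d)" using assms(1) d by (simp add: smooth_atlas_def is_chart_def)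
  moreover have "Ck_on k (snd d ` fst d) (\<lambda>x. u (chart_inv d x))"
    using assms(2) d unfolding pos_smooth_def smooth_fun_def smooth_on_def by blast
  ultimately show "Ck_on k (snd d ` fst d) (\<lambda>x. c * u (chart_inv d x))"
    by (rule Ck_on_cmult)
next
  show "0 < c * u p" for p using assms(2,3) by (simp add: pos_smooth_def)
qed

lemma one_pos_smooth: "(\<lambda>p. 1) \<in> pos_smooth A"
  by (simp add: pos_smooth_def smooth_fun_def smooth_on_def Ck_on_const)

text \<open>
  If \<open>f\<close> is not measurable, neither is \<open>w * f\<close>, since \<open>w\<close> can be divided out; then both sides are \<open>0\<close>. Thus the
  formula covers integrands such as the scalar curvature, whose value at a point is computed in a chart that is
  chosen separately for each point.
\<close>
lemma integral_density_pos:
  fixes f w :: "'a \<Rightarrow> real"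
  assumes w: "w \<in> borel_measurable M" "\<And>x. 0 < w x"
  shows "integrable (density M w) f \<longleftrightarrow> integrable M (\<lambda>x. w x * f x)"
    and "(\<integral>x. f x \<partial>density M w) = (\<integral>x. w x * f x \<partial>M)"
proof -
  have *: "integrable (density M w) f \<longleftrightarrow> integrable M (\<lambda>x. w x * f x)"
  proof (cases "f \<in> borel_measurable M")
    case True
    then show ?thesis using integrable_density[OF True w(1)] w(2) by (simp add: less_imp_le)
  next
    case False
    have "\<not> integrable M (\<lambda>x. w x * f x)"
    proof
      assume "integrable M (\<lambda>x. w x * f x)"
      then have "(\<lambda>x. inverse (w x) * (w x * f x)) \<in> borel_measurable M"
        by (rule borel_measurable_times[OF borel_measurable_inverse[OF w(1)] borel_measurable_integrable])
      moreover have "inverse (w x) * (w x * f x) = f x" for x using w(2)[of x] by simp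
      ultimately show False using False by simp
    qed
    then show ?thesis using False by (auto dest: borel_measurable_integrable)
  qed
  then show "integrable (density M w) f \<longleftrightarrow> integrable M (\<lambda>x. w x * f x)" .
  show "(\<integral>x. f x \<partial>density M w) = (\<integral>x. w x * f x \<partial>M)"
  proof (cases "f \<in> borel_measurable M")
    case True
    then show ?thesis using integral_density[OF True w(1)] w(2) by (simp add: less_imp_le)
  next
    case False
    then have "\<not> integrable (density M w) f" by (auto dest: borel_measurable_integrable)
    then show ?thesis using * by (simp add: not_integrable_integral_eq)
  qed
qed

text \<open>
  Multiplying \<open>u\<close> by \<open>c\<close> moves along the ray from the parameter \<open>1\<close> to \<open>c^2\<close>.
\<close>
lemma energy_rescale:
  assumes "0 < m" "0 < n" "0 < c" "0 < V"
  shows "rescaled_energy m n (c powr (2 - m - n) * S) (c powr (2 - m - n) * P) (c powr (- m - n) * V) 1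
    = rescaled_energy m n S P V (c\<^sup>2)"
proof -
  have 1: "c powr (2 - m - n) * S / (c powr (- m - n) * V) = c\<^sup>2 * S / V"
  proof -
    have e: "2 - m - n = 2 + (- m - n)" by simp
    have "c powr (2 - m - n) = c\<^sup>2 * c powr (- m - n)"
      unfolding e powr_add using assms(3) by (simp add: powr_numeral)
    then show ?thesis using assms by simp
  qed
  have "c powr (2 - m - n) * (c powr (- m - n) * V) powr (2 / m - 1)
      = (c powr (2 - m - n) * c powr ((- m - n) * (2 / m - 1))) * V powr (2 / m - 1)"
    using assms by (simp add: powr_mult powr_powr)
  also have "c powr (2 - m - n) * c powr ((- m - n) * (2 / m - 1)) = c powr (2 * (- n / m))"
    using assms by (simp add: powr_add[symmetric] field_simps)
  also have "c powr (2 * (- n / m)) = (c\<^sup>2) powr (- n / m)"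
    using assms(3) powr_powr[of c 2 "- n / m"] by (simp add: powr_numeral)
  finally have "c powr (2 - m - n) * (c powr (- m - n) * V) powr (2 / m - 1) = (c\<^sup>2) powr (- n / m) * V powr (2 / m - 1)" .
  then have 2: "c powr (2 - m - n) * P * (c powr (- m - n) * V) powr (2 / m - 1) = P * V powr (2 / m - 1) * (c\<^sup>2) powr (- n / m)"
    by (metis mult.assoc mult.commute)
  show ?thesis
    unfolding rescaled_energy_def using assms 1 2 by simp
qed

text \<open>
  The constraint says \<open>\<tau> = V^(-2/m)\<close>, which is inserted into the energy of the pair \<open>(u, \<tau>)\<close>.
\<close>
lemma energy_one_of_constraint:
  assumes "0 < m" "0 < n" "0 < V" "0 < \<tau>" "\<tau> powr (m / 2) * V = 1"
  shows "\<tau> powr (m / 2) * (S + m / \<tau> * P) = rescaled_energy m n S P V 1"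
proof -
  have t: "\<tau> powr (m / 2) = 1 / V" using assms by (simp add: field_simps)
  have "V = \<tau> powr (- (m / 2))" using t assms by (simp add: powr_minus field_simps)
  then have "V powr (2 / m - 1) = \<tau> powr (- (m / 2) * (2 / m - 1))" by (simp add: powr_powr)
  also have "- (m / 2) * (2 / m - 1) = m / 2 - 1" using assms by (simp add: field_simps)
  also have "\<tau> powr (m / 2 - 1) = \<tau> powr (m / 2) / \<tau>" using assms by (simp add: powr_diff)
  finally have "V powr (2 / m - 1) = 1 / (V * \<tau>)" using t by simp
  then show ?thesis unfolding t rescaled_energy_def using assms by (simp add: field_simps)
qed

context
  fixes A :: "('a::t2_space, 'n::finite) chart set"
    and g :: "('a, 'n) metric" and v :: "'a \<Rightarrow> real" and m :: real
  assumes smms: "compact_smms A g v"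
begin

lemma smms_facts:
  "compact (UNIV :: 'a set)" "smooth_atlas A" "riemannian_metric A g" "smooth_fun A v" "\<And>p. 0 < v p"
  using smms by (auto simp: compact_smms_def pos_smooth_def)

definition conf_curvature :: "('a \<Rightarrow> real) \<Rightarrow> 'a \<Rightarrow> real" where
  "conf_curvature u p = weighted_scalar A (conf_metric u g) (conf_weight u v) m p * conf_weight u v p powr m"

definition total_curvature :: "('a \<Rightarrow> real) \<Rightarrow> real" where
  "total_curvature u = (\<integral>p. conf_curvature u p \<partial>vol A (conf_metric u g))"

definition weighted_volume :: "('a \<Rightarrow> real) \<Rightarrow> real \<Rightarrow> real" where
  "weighted_volume u a = (\<integral>p. conf_weight u v p powr a \<partial>vol A (conf_metric u g))"

text \<open>
  If the curvature term is not integrable, its integral is \<open>0\<close> by convention, and so is the integral of its sum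
  with the potential term. The contribution of the potential to the energy is therefore \<open>0\<close> in that case. On
  such rays the Yamabe quotient is \<open>0\<close> as well, which agrees with the infimum \<open>0\<close> of the energy.
\<close>
definition effective_potential :: "('a \<Rightarrow> real) \<Rightarrow> real" where
  "effective_potential u = (if integrable (vol A (conf_metric u g)) (conf_curvature u)
     then weighted_volume u (m - 2) else 0)"

lemma pos_smoothD:
  assumes "u \<in> pos_smooth A"
  shows "continuous_on UNIV u" "smooth_fun A u" "0 < u p"
  using assms smooth_fun_continuous[OF smms_facts(2)] by (auto simp: pos_smooth_def)

text \<open>
  A constant factor \<open>c\<close> of \<open>u\<close> multiplies the conformal metric by \<open>c^(-2)\<close> and the conformal weight by \<open>1 / c\<close>;
  a factor \<open>s\<close> of \<open>v\<close> has no effect.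
\<close>
lemma weighted_scalar_conf_rescale:
  assumes u: "u \<in> pos_smooth A" and c: "0 < c" and s: "0 < s"
  shows "weighted_scalar A (conf_metric (\<lambda>p. c * u p) g) (conf_weight (\<lambda>p. c * u p) (\<lambda>p. s * v p)) m p
    = c\<^sup>2 * weighted_scalar A (conf_metric u g) (conf_weight u v) m p"
proof -
  let ?c = "chart_at A p"
  have "p \<in> (\<Union>c\<in>A. fst c)" using smms_facts(2) by (simp add: smooth_atlas_def)
  then have "\<exists>c. c \<in> A \<and> p \<in> fst c" by blast
  then have ca: "?c \<in> A" "p \<in> fst ?c" unfolding chart_at_def by (metis (mono_tags, lifting) someI_ex)+
  have ch: "is_chart ?c" using ca(1) smms_facts(2) by (simp add: smooth_atlas_def)
  let ?S = "snd ?c ` fst ?c"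
  have us: "smooth_on ?S (\<lambda>x. u (chart_inv ?c x))" using pos_smoothD(2)[OF u] ca by (simp add: smooth_fun_def)
  have vs: "smooth_on ?S (\<lambda>x. v (chart_inv ?c x))" using smms_facts(4) ca by (simp add: smooth_fun_def)
  have gs: "smooth_on ?S (\<lambda>x. g ?c (chart_inv ?c x) $ i $ j)" for i j
    using smms_facts(3) ca unfolding riemannian_metric_def by blast
  have up: "u q \<noteq> 0" for q using pos_smoothD(3)[OF u, of q] by simp
  have 1: "conf_metric (\<lambda>p. c * u p) g = (\<lambda>d q. inverse (c\<^sup>2) *\<^sub>R conf_metric u g d q)"
    by (intro ext) (simp add: conf_metric_def power_mult_distrib)
  have 2: "conf_weight (\<lambda>p. c * u p) (\<lambda>p. s * v p) = (\<lambda>q. (s / c) * conf_weight u v q)"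
    by (intro ext) (simp add: conf_weight_def field_simps)
  have "weighted_scalar A (\<lambda>d q. inverse (c\<^sup>2) *\<^sub>R conf_metric u g d q) (\<lambda>q. (s / c) * conf_weight u v q) m p
    = inverse (inverse (c\<^sup>2)) * weighted_scalar A (conf_metric u g) (conf_weight u v) m p"
  proof (rule weighted_scalar_scaleR[OF ch refl ca(2)])
    show "(\<lambda>x. conf_metric u g ?c (chart_inv ?c x) $ i $ j) differentiable at x" if "x \<in> ?S" for x i j
      unfolding conf_metric_def vector_scaleR_component real_scaleR_def
      using smooth_on_differentiable[OF us that] smooth_on_differentiable[OF gs that] up
      by (intro differentiable_mult differentiable_inverse differentiable_power) auto
    show "invertible (conf_metric u g ?c q)" if "q \<in> fst ?c" for q
    proof -
      have "det (g ?c q) > 0"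
        by (rule det_pos_of_positive_definite[OF riemannian_metric_positive_definite[OF smms_facts(3) ca(1) that]])
      then show ?thesis
        using up[of q] by (simp add: conf_metric_def invertible_det_nz det_scaleR)
    qed
    show "(\<lambda>x. conf_weight u v (chart_inv ?c x)) differentiable at x" if "x \<in> ?S" for x
      unfolding conf_weight_def
      by (rule quotient_twice_differentiable(1)[OF chart_open(2)[OF ch] us vs _ that]) (rule up)
    show "partial_deriv i (\<lambda>x. conf_weight u v (chart_inv ?c x)) differentiable at x" if "x \<in> ?S" for x i
      unfolding conf_weight_def
      by (rule quotient_twice_differentiable(2)[OF chart_open(2)[OF ch] us vs _ that]) (rule up)
  qed (use c s in auto)
  then show ?thesis unfolding 1 2 by simp
qed

lemma conf_vol_integral:
  fixes f :: "'a \<Rightarrow> real"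
  assumes u: "u \<in> pos_smooth A"
  shows "integrable (vol A (conf_metric u g)) f \<longleftrightarrow> integrable (vol A g) (\<lambda>p. inverse (u p) ^ CARD('n) * f p)"
    and "(\<integral>p. f p \<partial>vol A (conf_metric u g)) = (\<integral>p. inverse (u p) ^ CARD('n) * f p \<partial>vol A g)"
proof -
  note cu = pos_smoothD(1)[OF u]
  have up: "0 < u p" for p using pos_smoothD(3)[OF u] .
  then have nz: "u p \<noteq> 0" for p by (metis less_irrefl)
  have w: "(\<lambda>p. inverse (u p) ^ CARD('n)) \<in> borel_measurable (vol A g)"
    using cu nz by (intro measurable_vol_of_continuous[OF smms_facts(1-3)] continuous_intros) auto
  have p: "0 < inverse (u p) ^ CARD('n)" for p using up by simp
  show "integrable (vol A (conf_metric u g)) f \<longleftrightarrow> integrable (vol A g) (\<lambda>p. inverse (u p) ^ CARD('n) * f p)"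
    "(\<integral>p. f p \<partial>vol A (conf_metric u g)) = (\<integral>p. inverse (u p) ^ CARD('n) * f p \<partial>vol A g)"
    unfolding vol_conf_metric[OF smms_facts(1-3) borel_measurable_continuous_onI[OF cu] up]
    by (rule integral_density_pos[OF w p])+
qed

lemma continuous_on_weight_powr:
  assumes u: "u \<in> pos_smooth A"
  shows "continuous_on UNIV (\<lambda>p. inverse (u p) ^ CARD('n) * conf_weight u v p powr a)"
    and "0 < inverse (u p) ^ CARD('n) * conf_weight u v p powr a"
proof -
  have up: "0 < u p" for p using pos_smoothD(3)[OF u] .
  note vp = smms_facts(5)
  have nz: "u p \<noteq> 0" "v p \<noteq> 0" for p using up[of p] vp[of p] by auto
  show "continuous_on UNIV (\<lambda>p. inverse (u p) ^ CARD('n) * conf_weight u v p powr a)"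
    unfolding conf_weight_def using nz
    by (intro continuous_intros pos_smoothD(1)[OF u] smooth_fun_continuous[OF smms_facts(2,4)]) auto
  show "0 < inverse (u p) ^ CARD('n) * conf_weight u v p powr a"
    using up vp by (simp add: conf_weight_def nz less_imp_neq[symmetric])
qed

lemma weighted_volume_pos: "u \<in> pos_smooth A \<Longrightarrow> 0 < weighted_volume u a"
  unfolding weighted_volume_def conf_vol_integral(2)
  by (intro integral_vol_pos[OF smms_facts(1-3)] continuous_on_weight_powr)

lemma integrable_weight_powr:
  "u \<in> pos_smooth A \<Longrightarrow> integrable (vol A (conf_metric u g)) (\<lambda>p. conf_weight u v p powr a)"
  unfolding conf_vol_integral(1)
  by (intro integrable_vol_of_continuous[OF smms_facts(1-3)] continuous_on_weight_powr)

lemma conf_vol_integral_rescale: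
  fixes f :: "'a \<Rightarrow> real"
  assumes u: "u \<in> pos_smooth A" and c: "0 < c"
  shows "integrable (vol A (conf_metric (\<lambda>p. c * u p) g)) f \<longleftrightarrow> integrable (vol A (conf_metric u g)) f"
    and "(\<integral>p. f p \<partial>vol A (conf_metric (\<lambda>p. c * u p) g)) = c powr (- real CARD('n)) * (\<integral>p. f p \<partial>vol A (conf_metric u g))"
proof -
  note cu = pos_smooth_cmult[OF smms_facts(2) u c]
  have e: "(\<lambda>p. inverse (c * u p) ^ CARD('n) * f p) = (\<lambda>p. c powr (- real CARD('n)) * (inverse (u p) ^ CARD('n) * f p))"
    using c by (simp add: fun_eq_iff powr_minus powr_realpow power_mult_distrib power_inverse mult_ac)
  show "integrable (vol A (conf_metric (\<lambda>p. c * u p) g)) f \<longleftrightarrow> integrable (vol A (conf_metric u g)) f"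
    unfolding conf_vol_integral(1)[OF u] conf_vol_integral(1)[OF cu] e using c by simp
  show "(\<integral>p. f p \<partial>vol A (conf_metric (\<lambda>p. c * u p) g)) = c powr (- real CARD('n)) * (\<integral>p. f p \<partial>vol A (conf_metric u g))"
    unfolding conf_vol_integral(2)[OF u] conf_vol_integral(2)[OF cu] e by simp
qed

lemma conf_weight_powr_rescale:
  assumes u: "u \<in> pos_smooth A" and c: "0 < c"
  shows "conf_weight (\<lambda>p. c * u p) v p powr a = c powr (- a) * conf_weight u v p powr a"
proof -
  have "conf_weight (\<lambda>p. c * u p) v p = inverse c * conf_weight u v p"
    by (simp add: conf_weight_def)
  moreover have "0 < conf_weight u v p" using pos_smoothD(3)[OF u] smms_facts(5) by (simp add: conf_weight_def)
  ultimately show ?thesis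
    using c by (simp add: powr_mult powr_minus inverse_powr)
qed

lemma weighted_volume_rescale:
  assumes u: "u \<in> pos_smooth A" and c: "0 < c"
  shows "weighted_volume (\<lambda>p. c * u p) a = c powr (- a - real CARD('n)) * weighted_volume u a"
proof -
  have "- a - real CARD('n) = - real CARD('n) + - a" by simp
  then show ?thesis
    unfolding weighted_volume_def conf_vol_integral_rescale(2)[OF u c] conf_weight_powr_rescale[OF u c]
    by (simp only: powr_add) simp
qed

lemma conf_curvature_rescale:
  assumes u: "u \<in> pos_smooth A" and c: "0 < c"
  shows "conf_curvature (\<lambda>p. c * u p) p = c powr (2 - m) * conf_curvature u p"
proof -
  have "weighted_scalar A (conf_metric (\<lambda>p. c * u p) g) (conf_weight (\<lambda>p. c * u p) v) m p
    = c\<^sup>2 * weighted_scalar A (conf_metric u g) (conf_weight u v) m p"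
    using weighted_scalar_conf_rescale[OF u c, of 1] by simp
  moreover have "c\<^sup>2 * c powr (- m) = c powr (2 - m)"
    using c powr_add[of c 2 "- m"] by (simp add: powr_numeral)
  ultimately show ?thesis
    unfolding conf_curvature_def conf_weight_powr_rescale[OF u c] by (metis mult.assoc mult.commute)
qed

lemma total_curvature_rescale:
  assumes u: "u \<in> pos_smooth A" and c: "0 < c"
  shows "total_curvature (\<lambda>p. c * u p) = c powr (2 - m - real CARD('n)) * total_curvature u"
  unfolding total_curvature_def conf_vol_integral_rescale(2)[OF u c] conf_curvature_rescale[OF u c]
  by (simp add: powr_add[symmetric] mult.assoc[symmetric])

lemma effective_potential_rescale:
  assumes u: "u \<in> pos_smooth A" and c: "0 < c"
  shows "effective_potential (\<lambda>p. c * u p) = c powr (2 - m - real CARD('n)) * effective_potential u"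
proof -
  have "integrable (vol A (conf_metric (\<lambda>p. c * u p) g)) (conf_curvature (\<lambda>p. c * u p))
      \<longleftrightarrow> integrable (vol A (conf_metric u g)) (conf_curvature u)"
    unfolding conf_vol_integral_rescale(1)[OF u c] conf_curvature_rescale[OF u c, abs_def]
    using c by simp
  then show ?thesis
    by (simp add: effective_potential_def weighted_volume_rescale[OF u c])
qed

lemma yamabe_quotient_conf:
  "yamabe_quotient A (conf_metric u g) (conf_weight u v) m
    = yamabe_ratio m (real CARD('n)) (total_curvature u) (weighted_volume u (m - 2)) (weighted_volume u m)"
  by (simp add: yamabe_quotient_def yamabe_ratio_def total_curvature_def conf_curvature_def weighted_volume_def)

text \<open>
  With \<open>w\<close> the conformal weight, \<open>w^(-2) * w^m = w^(m-2)\<close> makes the integral of the potential term a multiple of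
  \<open>P\<close>. This term is integrable, so the sum is integrable if and only if the curvature term is.
\<close>
lemma W_functional_conf:
  assumes u: "u \<in> pos_smooth A" and t: "0 < \<tau>"
  shows "W_functional A (conf_metric u g) (conf_weight u (\<lambda>p. sqrt \<tau> * v p)) m 1
    = \<tau> powr (m / 2) * (total_curvature u + m / \<tau> * effective_potential u)"
proof -
  let ?M = "vol A (conf_metric u g)"
  let ?w = "conf_weight u v"
  have w: "0 < ?w p" for p using pos_smoothD(3)[OF u] smms_facts(5) by (simp add: conf_weight_def)
  have cw: "conf_weight u (\<lambda>p. sqrt \<tau> * v p) = (\<lambda>p. sqrt \<tau> * ?w p)"
    by (simp add: conf_weight_def fun_eq_iff)
  have ws: "weighted_scalar A (conf_metric u g) (\<lambda>p. sqrt \<tau> * ?w p) m p = weighted_scalar A (conf_metric u g) ?w m p" for p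
    using weighted_scalar_conf_rescale[OF u, of 1 "sqrt \<tau>" p] t unfolding cw[symmetric] by simp
  have integrand: "(weighted_scalar A (conf_metric u g) ?w m p + m * 1 * inverse ((sqrt \<tau> * ?w p)\<^sup>2)) * (sqrt \<tau> * ?w p) powr m
      = \<tau> powr (m / 2) * (conf_curvature u p + m / \<tau> * ?w p powr (m - 2))" for p
  proof -
    let ?ws = "weighted_scalar A (conf_metric u g) ?w m p"
    let ?I = "inverse ((sqrt \<tau> * ?w p)\<^sup>2)" and ?Y = "(sqrt \<tau> * ?w p) powr m"
    have Y: "?Y = \<tau> powr (m / 2) * ?w p powr m"
      using t w[of p] by (simp add: powr_mult powr_half_sqrt[symmetric] powr_powr)
    have "?I * ?w p powr m = ?w p powr (m - 2) / \<tau>"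
      using t w[of p] by (simp add: power_mult_distrib powr_diff powr_numeral field_simps)
    then have IY: "?I * ?Y = \<tau> powr (m / 2) * (?w p powr (m - 2) / \<tau>)"
      unfolding Y by (metis mult.left_commute)
    have "(?ws + m * 1 * ?I) * ?Y = ?ws * ?Y + m * (?I * ?Y)" by (simp add: distrib_right)
    also have "\<dots> = ?ws * (\<tau> powr (m / 2) * ?w p powr m) + m * (\<tau> powr (m / 2) * (?w p powr (m - 2) / \<tau>))"
      unfolding IY unfolding Y ..
    also have "\<dots> = \<tau> powr (m / 2) * (conf_curvature u p + m / \<tau> * ?w p powr (m - 2))"
      by (simp add: conf_curvature_def algebra_simps)
    finally show ?thesis .
  qed
  have W: "W_functional A (conf_metric u g) (conf_weight u (\<lambda>p. sqrt \<tau> * v p)) m 1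
      = \<tau> powr (m / 2) * (\<integral>p. conf_curvature u p + m / \<tau> * ?w p powr (m - 2) \<partial>?M)"
    unfolding W_functional_def cw ws integrand by simp
  note i = integrable_mult_right[OF integrable_weight_powr[OF u, of "m - 2"], of "m / \<tau>"]
  show ?thesis
  proof (cases "integrable ?M (conf_curvature u)")
    case True
    then show ?thesis
      unfolding W using i by (simp add: effective_potential_def total_curvature_def weighted_volume_def)
  next
    case False
    have "\<not> integrable ?M (\<lambda>p. conf_curvature u p + m / \<tau> * ?w p powr (m - 2))"
    proof
      assume "integrable ?M (\<lambda>p. conf_curvature u p + m / \<tau> * ?w p powr (m - 2))"
      from Bochner_Integration.integrable_diff[OF this i] False show False by simp
    qed
    then show ?thesis
      unfolding W using False by (simp add: effective_potential_def total_curvature_def not_integrable_integral_eq)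
  qed
qed

lemma constraint_integral:
  assumes u: "u \<in> pos_smooth A" and t: "0 < \<tau>"
  shows "(\<integral>p. u p powr (- m - real CARD('n)) * (sqrt \<tau> * v p) powr m \<partial>vol A g) = \<tau> powr (m / 2) * weighted_volume u m"
proof -
  have "u p powr (- m - real CARD('n)) * (sqrt \<tau> * v p) powr m
      = \<tau> powr (m / 2) * (inverse (u p) ^ CARD('n) * conf_weight u v p powr m)" for p
  proof -
    have up: "0 < u p" and vp: "0 < v p" using pos_smoothD(3)[OF u] smms_facts(5) by auto
    have "(sqrt \<tau> * v p) powr m = \<tau> powr (m / 2) * v p powr m"
      using t vp by (simp add: powr_mult powr_half_sqrt[symmetric] powr_powr)
    moreover have "u p powr (- m - real CARD('n)) = u p powr (- m) * inverse (u p) ^ CARD('n)"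
      using up powr_add[of "u p" "- m" "- real CARD('n)"] by (simp add: powr_minus powr_realpow power_inverse)
    moreover have "conf_weight u v p powr m = u p powr (- m) * v p powr m"
      using up vp by (simp add: conf_weight_def powr_mult powr_minus inverse_powr)
    ultimately show ?thesis by simp
  qed
  then show ?thesis by (simp add: weighted_volume_def conf_vol_integral(2)[OF u])
qed

section \<open>The m-energy\<close>

lemma m_energy_eq:
  "m_energy A g v m = (INF \<tau>\<in>{0<..}. INF u\<in>{u\<in>pos_smooth A. \<tau> powr (m / 2) * weighted_volume u m = 1}.
     ereal (\<tau> powr (m / 2) * (total_curvature u + m / \<tau> * effective_potential u)))"
  unfolding m_energy_def m_mu_energy_def
  by (intro INF_cong refl) (auto simp: constraint_integral W_functional_conf)

text \<open>
  A pair \<open>(u, \<tau>)\<close> that satisfies the constraint is the point with parameter \<open>1\<close> on the ray of \<open>u\<close>. Conversely, the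
  point with parameter \<open>x\<close> on the ray of \<open>u\<close> is the pair of \<open>sqrt x * u\<close> and the \<open>\<tau>\<close> that the constraint
  prescribes, which exists because \<open>m > 0\<close>.
\<close>
lemma m_energy_eq_INF_energy:
  assumes m: "0 < m"
  shows "m_energy A g v m = (INF (u, x)\<in>pos_smooth A \<times> {0<..}.
    ereal (rescaled_energy m (real CARD('n)) (total_curvature u) (effective_potential u) (weighted_volume u m) x))" (is "?L = ?R")
proof (rule antisym)
  have n0: "0 < real CARD('n)" by simp
  show "?R \<le> ?L"
    unfolding m_energy_eq
  proof (intro INF_greatest)
    fix \<tau> :: real and u assume t: "\<tau> \<in> {0<..}" and u: "u \<in> {u\<in>pos_smooth A. \<tau> powr (m / 2) * weighted_volume u m = 1}"
    have "\<tau> powr (m / 2) * (total_curvature u + m / \<tau> * effective_potential u)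
        = rescaled_energy m (real CARD('n)) (total_curvature u) (effective_potential u) (weighted_volume u m) 1"
      using t u m weighted_volume_pos by (intro energy_one_of_constraint) auto
    then show "?R \<le> ereal (\<tau> powr (m / 2) * (total_curvature u + m / \<tau> * effective_potential u))"
      using u by (intro INF_lower2[of "(u, 1)"]) auto
  qed
  show "?L \<le> ?R"
  proof (rule INF_greatest, clarify)
    fix u and x :: real assume u: "u \<in> pos_smooth A" and x: "0 < x"
    define c where "c = sqrt x"
    have c: "0 < c" "c\<^sup>2 = x" using x by (simp_all add: c_def)
    let ?u = "\<lambda>p. c * u p"
    note cu = pos_smooth_cmult[OF smms_facts(2) u c(1)]
    define \<tau> where "\<tau> = weighted_volume ?u m powr (- (2 / m))"
    have t: "0 < \<tau>" "\<tau> powr (m / 2) * weighted_volume ?u m = 1"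
      unfolding \<tau>_def powr_powr using weighted_volume_pos[OF cu, of m] m by (simp_all add: powr_minus)
    have "\<tau> powr (m / 2) * (total_curvature ?u + m / \<tau> * effective_potential ?u)
        = rescaled_energy m (real CARD('n)) (total_curvature ?u) (effective_potential ?u) (weighted_volume ?u m) 1"
      using energy_one_of_constraint[OF m n0 weighted_volume_pos[OF cu] t] .
    also have "\<dots> = rescaled_energy m (real CARD('n)) (total_curvature u) (effective_potential u) (weighted_volume u m) x"
      unfolding total_curvature_rescale[OF u c(1)] effective_potential_rescale[OF u c(1)] weighted_volume_rescale[OF u c(1)]
      using energy_rescale[OF m n0 c(1) weighted_volume_pos[OF u]] c(2) by simp
    finally show "?L \<le> ereal (rescaled_energy m (real CARD('n)) (total_curvature u) (effective_potential u) (weighted_volume u m) x)"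
      unfolding m_energy_eq using cu t by (intro INF_lower2[of \<tau>] INF_lower2[of ?u]) auto
  qed
qed

text \<open>
  For \<open>m = 0\<close> the energy is \<open>S\<close> under the constraint \<open>V = 1\<close>, where \<open>S\<close> equals the Yamabe quotient. As the
  quotient is invariant under constant factors of \<open>u\<close>, the constraint does not change its infimum.
\<close>
lemma m_energy_eq_yamabe:
  assumes m: "m = 0"
  shows "m_energy A g v m = weighted_yamabe A g v m"
proof -
  have n0: "0 < real CARD('n)" by simp
  have q: "yamabe_ratio m (real CARD('n)) S P V = S * V powr ((2 - real CARD('n)) / real CARD('n))" if "0 < P" "0 < V" for S P V
    using that by (simp add: yamabe_ratio_def m powr_minus[symmetric] divide_inverse minus_divide_left powr_zero_eq_one)
       (simp add: powr_minus[symmetric] left_diff_distrib)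
  have "m_energy A g v m = (INF u\<in>{u\<in>pos_smooth A. weighted_volume u m = 1}. ereal (total_curvature u))"
    unfolding m_energy_eq by (simp add: m)
  also have "\<dots> = weighted_yamabe A g v m"
  proof (rule antisym)
    show "weighted_yamabe A g v m \<le> (INF u\<in>{u\<in>pos_smooth A. weighted_volume u m = 1}. ereal (total_curvature u))"
    proof (rule INF_greatest)
      fix u assume "u \<in> {u\<in>pos_smooth A. weighted_volume u m = 1}"
      then show "weighted_yamabe A g v m \<le> ereal (total_curvature u)"
        unfolding weighted_yamabe_def yamabe_quotient_conf
        by (intro INF_lower2[of u]) (auto simp: q weighted_volume_pos)
    qed
    show "(INF u\<in>{u\<in>pos_smooth A. weighted_volume u m = 1}. ereal (total_curvature u)) \<le> weighted_yamabe A g v m"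
      unfolding weighted_yamabe_def yamabe_quotient_conf
    proof (rule INF_greatest)
      fix u assume u: "u \<in> pos_smooth A"
      let ?V = "weighted_volume u m"
      note V = weighted_volume_pos[OF u, of m] and P = weighted_volume_pos[OF u, of "m - 2"]
      \<comment> \<open>The volume is multiplied by c^(-n), so this c normalises it.\<close>
      define c where "c = ?V powr (1 / real CARD('n))"
      have c: "0 < c" using V by (simp add: c_def)
      let ?u = "\<lambda>p. c * u p"
      note cu = pos_smooth_cmult[OF smms_facts(2) u c]
      have "weighted_volume ?u m = 1"
        unfolding weighted_volume_rescale[OF u c] using V by (simp add: c_def m powr_powr powr_minus)
      moreover have "total_curvature ?u = yamabe_ratio m (real CARD('n)) (total_curvature u) (weighted_volume u (m - 2)) ?V"
        unfolding total_curvature_rescale[OF u c] q[OF P V] by (simp add: c_def m powr_powr)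
      ultimately show "(INF u\<in>{u\<in>pos_smooth A. weighted_volume u m = 1}. ereal (total_curvature u))
          \<le> ereal (yamabe_ratio m (real CARD('n)) (total_curvature u) (weighted_volume u (m - 2)) ?V)"
        using cu by (intro INF_lower2[of ?u]) auto
    qed
  qed
  finally show ?thesis .
qed

end

theorem proposition3p14:
  fixes A :: "('a::t2_space, 'n::finite) chart set"
    and g :: "('a, 'n) metric" and v :: "'a \<Rightarrow> real" and m :: real and \<sigma> :: ereal
  assumes "0 \<le> m"
    and "compact_smms A g v"
    and "\<sigma> = weighted_yamabe A g v m"
  shows "m_energy A g v m =
    (if \<sigma> < 0 then (if m = 0 then \<sigma> else - \<infinity>)
     else if \<sigma> = 0 then 0
     else ereal ((m + real CARD('n)) *
            (real_of_ereal \<sigma> / real CARD('n)) powr (real CARD('n) / (m + real CARD('n)))))"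
proof (cases "m = 0")
  case True
  have "\<sigma> \<le> ereal (yamabe_quotient A (conf_metric (\<lambda>p. 1) g) (conf_weight (\<lambda>p. 1) v) m)"
    unfolding assms(3) weighted_yamabe_def by (rule INF_lower) (rule one_pos_smooth)
  \<comment> \<open>The last case of the formula goes through the real value of the Yamabe constant.\<close>
  then have "\<sigma> \<noteq> \<infinity>" by auto
  moreover have "m_energy A g v m = \<sigma>"
    using m_energy_eq_yamabe[OF assms(2) True] assms(3) by simp
  ultimately show ?thesis
    using True by (cases \<sigma>) auto
next
  case False
  then have m: "0 < m" using assms(1) by simp
  note smms = assms(2)
  have "m_energy A g v m = (if \<sigma> < 0 then - \<infinity> else if \<sigma> = 0 then 0
      else ereal (envelope m (real CARD('n)) (real_of_ereal \<sigma>)))"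
    unfolding m_energy_eq_INF_energy[OF smms m]
  proof (rule inf_energy_eq_envelope_inf_quotient[OF m, where P = "\<lambda>u. weighted_volume A g v u (m - 2)"])
    show "pos_smooth A \<noteq> {}" using one_pos_smooth by blast
    show "\<sigma> = (INF u\<in>pos_smooth A. ereal (yamabe_ratio m (real CARD('n)) (total_curvature A g v m u)
        (weighted_volume A g v u (m - 2)) (weighted_volume A g v u m)))"
      unfolding assms(3) weighted_yamabe_def yamabe_quotient_conf[OF smms] ..
    show "0 \<le> effective_potential A g v m u" if "u \<in> pos_smooth A" for u
      using weighted_volume_pos[OF smms that, of "m - 2"] by (simp add: effective_potential_def[OF smms])
    show "effective_potential A g v m u = weighted_volume A g v u (m - 2)"
      if "u \<in> pos_smooth A" "total_curvature A g v m u \<noteq> 0" for u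
      using that(2) by (auto simp: effective_potential_def[OF smms] total_curvature_def[OF smms] dest: not_integrable_integral_eq)
  qed (use weighted_volume_pos[OF smms] in auto)
  then show ?thesis using False by (simp add: envelope_def)
qed

end
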